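(* Let $s>d/2$ satisfy $s\ge \max(s_r,s_a)$ and let $R>0$. Then there is a constant $C>0$ such that for all integers $n\ge 1$, all $\sigma>0$ and all $\beta>0$, $$e(\beta,\sigma,n)\le C\Big(\sigma\,\min(\beta^{-1}n^{-1/d},1)^{d/2}+n^{-s_a/d}+\beta^{s_r}\Big).$$ In particular, for every constant $A>0$ there is a constant $C_A>0$ such that for all $n\ge 1$ and $\sigma>0$, $$\inf_{\beta>0}e(\beta,\sigma,n)\le \begin{cases} C_A\big(\sigma+n^{-s_a/d}\big) & \text{if } \sigma\le A\,n^{-s_r/d},\\[2pt] C_A\big(\sigma^{2s_r/(2s_r+d)}\,n^{-s_r/(2s_r+d)}+n^{-s_a/d}\big) & \text{otherwise.}\end{cases}$$
   Context: Setting. $d\ge 1$ is an integer and $\Omega\subset\mathbb{R}^d$ is a smooth bounded connected open set. $\|\cdot\|$ is the $L^2(\Omega)$-norm, $\|\cdot\|_s$ the norm of the fractional Sobolev space $H^s(\Omega)$, $H^s_0(\Omega)$ the closure of $C_c^\infty(\Omega)$ in $H^s(\Omega)$, and $\mathcal{F}(s,R)=\{f\in H^s_0(\Omega):\|f\|_s\le R\}$. Always $s>d/2$, so that elements of $H^s_0(\Omega)$ are continuous on $\overline\Omega$. Convention. $u\lesssim v$ means $u\le Cv$ with a constant $C>0$ independent of $n,\sigma,\beta,i$ (it may depend on $\Omega,d,K,s,R,s_a,s_r$ and the given families); $u\sim v$ means $u\lesssim v$ and $v\lesssim u$. Discretisation. For each integer $n\ge1$ we are given points $x_1,\dots,x_n\in\overline\Omega$,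 functions $\phi_1,\dots,\phi_n\in C^0(\overline\Omega)$ (all depending on $n$) and a number $h=h_n>0$ with $h\sim n^{-1/d}$. Put $E_nf=(f(x_i))_{1\le i\le n}$ and $P_nz=\sum_{i=1}^n z_i\phi_i$ for $z\in\mathbb{R}^n$. Assume: - $\|\phi_i\|\sim h^{d/2}$ and $\|\phi_i\|_{L^1(\Omega)}\sim h^d$, uniformly in $i$ and $n$; - for a number $s_a>0$ (the order of the approximation method): for every $R>0$ and $s\ge s_a$ (with $s>d/2$), $\sup_{f\in\mathcal{F}(s,R)}\|P_nE_nf-f\|\sim h^{s_a}$. Regularisation. $K:\mathbb{R}^d\to\mathbb{R}$ is smooth, compactly supported, $\int_{\mathbb{R}^d}K=1$; $K_\beta=\beta^{-d}K(\beta^{-1}\cdot)$ for $\beta>0$; and for $g\in L^2(\Omega)$, $(K_\beta*g)(x)=\int_\Omega K_\beta(x-y)g(y)\,dy$. The integer $s_r$, with $s_r-1\ge1$, is such that $\int x_1^{r_1}\cdots x_d^{r_d}K(x)\,dx=0$ for all multi-indices with $1\le|r|\le s_r-1$, while this integral is nonzero for at least one multi-index with $|r|=s_r$. Assume that for all $s\ge s_r$ and $R>0$: $\sup_{f\in\mathcal{F}(s,R)}\|K_\beta*f-f\|\lesssim\beta^{s_r}$ for all $\beta>0$, and there is $\beta_0>0$ such that $\sup_{f\in\mathcal{F}(s,R)}\|K_\beta*f-f\|\gtrsim\beta^{s_r}$ for all $0<\beta\le\beta_0$. Data and error. $(y_\sigma)_i=f(x_i)+\sigma\xi_i$, $i=1,\dots,n$,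 where the $\xi_i$ are independent real random variables with mean $0$ and variance $1$. For $\beta>0$, $$e(\beta,\sigma,n)=\sup_{f\in\mathcal{F}(s,R)}\mathbb{E}\big[\|K_\beta*(P_ny_\sigma)-f\|^2\big]^{1/2}.$$ *)

theory Defs
  imports "HOL-Probability.Probability"
begin

section \<open>Smooth functions and smooth domains\<close>

text \<open>\<open>iter_partial [j1, ..., jk] f\<close> is the iterated classical partial derivative
  \<open>d_j1 ... d_jk f\<close>. Requiring every one of them to be (Frechet) differentiable everywhere
  makes all of them exist and be continuous, i.e. \<open>f\<close> is of class \<open>C^\<infinity>\<close>.\<close>

primrec iter_partial :: "'d::finite list \<Rightarrow> (real^'d \<Rightarrow> real) \<Rightarrow> real^'d \<Rightarrow> real" where
  "iter_partial [] f = f"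
| "iter_partial (j # js) f =
     (\<lambda>x. frechet_derivative (iter_partial js f) (at x) (axis j 1))"

definition smooth_fun :: "(real^'d::finite \<Rightarrow> real) \<Rightarrow> bool" where
  "smooth_fun f \<longleftrightarrow> (\<forall>js x. iter_partial js f differentiable (at x))"

definition tsupport :: "(real^'d::finite \<Rightarrow> real) \<Rightarrow> (real^'d) set" where
  "tsupport f = closure {x. f x \<noteq> 0}"

definition test_functions :: "(real^'d::finite) set \<Rightarrow> (real^'d \<Rightarrow> real) set" where
  "test_functions \<Omega> = {\<phi>. smooth_fun \<phi> \<and> compact (tsupport \<phi>) \<and> tsupport \<phi> \<subseteq> \<Omega>}"

text \<open>Near each boundary point, in a suitable orthonormal frame whose last vector is \<open>\<nu>\<close>,
  the set is the region strictly above the graph of a smooth function \<open>\<gamma>\<close> of the component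
  orthogonal to \<open>\<nu>\<close>. (\<open>\<gamma>\<close> is defined on the whole space, but only its values on the hyperplane
  orthogonal to \<open>\<nu>\<close> matter.)\<close>

definition smooth_boundary :: "(real^'d::finite) set \<Rightarrow> bool" where
  "smooth_boundary \<Omega> \<longleftrightarrow>
     (\<forall>p \<in> frontier \<Omega>. \<exists>r>0. \<exists>\<nu> \<gamma>. norm \<nu> = 1 \<and> smooth_fun \<gamma> \<and>
        (\<forall>x \<in> ball p r. x \<in> \<Omega> \<longleftrightarrow> \<gamma> (x - (x \<bullet> \<nu>) *\<^sub>R \<nu>) < x \<bullet> \<nu>))"

section \<open>Lebesgue norms\<close>

text \<open>Norms take values in \<^typ>\<open>ennreal\<close>, so that suprema and expectations of them
  are meaningful without integrability side conditions. Elements of \<open>L^2(\<Omega>)\<close> are represented by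
  Borel functions; values outside \<open>\<Omega>\<close> are irrelevant.\<close>

definition ennreal_sqrt :: "ennreal \<Rightarrow> ennreal" where
  "ennreal_sqrt u = (if u = \<top> then \<top> else ennreal (sqrt (enn2real u)))"

definition L2_norm_on :: "(real^'d::finite) set \<Rightarrow> (real^'d \<Rightarrow> real) \<Rightarrow> ennreal" where
  "L2_norm_on \<Omega> g = ennreal_sqrt (\<integral>\<^sup>+x\<in>\<Omega>. ennreal ((g x)\<^sup>2) \<partial>lborel)"

definition L1_norm_on :: "(real^'d::finite) set \<Rightarrow> (real^'d \<Rightarrow> real) \<Rightarrow> ennreal" where
  "L1_norm_on \<Omega> g = (\<integral>\<^sup>+x\<in>\<Omega>. ennreal \<bar>g x\<bar> \<partial>lborel)"

definition in_L2 :: "(real^'d::finite) set \<Rightarrow> (real^'d \<Rightarrow> real) \<Rightarrow> bool" where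
  "in_L2 \<Omega> g \<longleftrightarrow> set_borel_measurable lborel \<Omega> g \<and> L2_norm_on \<Omega> g < \<top>"

section \<open>Fractional Sobolev spaces\<close>

text \<open>Multi-indices are functions \<open>\<alpha> :: 'd \<Rightarrow> nat\<close> with \<open>|\<alpha>| = sum \<alpha> UNIV\<close>.
  A list \<open>js\<close> of coordinates realises \<open>\<alpha>\<close> if each \<open>j\<close> occurs \<open>\<alpha> j\<close> times in it; for smooth
  functions the order of the entries does not affect \<open>iter_partial js\<close>.\<close>

definition weak_derivative_on ::
  "(real^'d::finite) set \<Rightarrow> ('d \<Rightarrow> nat) \<Rightarrow> (real^'d \<Rightarrow> real) \<Rightarrow> (real^'d \<Rightarrow> real) \<Rightarrow> bool" where
  "weak_derivative_on \<Omega> \<alpha> f g \<longleftrightarrow>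
     (\<forall>\<phi> \<in> test_functions \<Omega>. \<forall>js. count_list js = \<alpha> \<longrightarrow>
        (LINT x:\<Omega>|lborel. f x * iter_partial js \<phi> x)
          = (-1) ^ sum \<alpha> UNIV * (LINT x:\<Omega>|lborel. g x * \<phi> x))"

text \<open>Weak derivatives are unique almost everywhere, so the choice below does not influence
  any of the integrals in which it is used.\<close>

definition weak_deriv ::
  "(real^'d::finite) set \<Rightarrow> ('d \<Rightarrow> nat) \<Rightarrow> (real^'d \<Rightarrow> real) \<Rightarrow> real^'d \<Rightarrow> real" where
  "weak_deriv \<Omega> \<alpha> f = (SOME g. in_L2 \<Omega> g \<and> weak_derivative_on \<Omega> \<alpha> f g)"

text \<open>Square of the Gagliardo seminorm of order \<open>\<theta> \<in> (0,1)\<close>.\<close>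

definition gagliardo_sq ::
  "real \<Rightarrow> (real^'d::finite) set \<Rightarrow> (real^'d \<Rightarrow> real) \<Rightarrow> ennreal" where
  "gagliardo_sq \<theta> \<Omega> g =
     (\<integral>\<^sup>+x\<in>\<Omega>. (\<integral>\<^sup>+y\<in>\<Omega>.
        ennreal ((g x - g y)\<^sup>2 / norm (x - y) powr (real CARD('d) + 2 * \<theta>)) \<partial>lborel) \<partial>lborel)"

text \<open>Sobolev--Slobodeckij norm of order \<open>s = m + \<theta>\<close> with \<open>m\<close> a natural number and
  \<open>0 \<le> \<theta> < 1\<close>.\<close>

definition sobolev_norm ::
  "real \<Rightarrow> (real^'d::finite) set \<Rightarrow> (real^'d \<Rightarrow> real) \<Rightarrow> ennreal" where
  "sobolev_norm s \<Omega> f =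
     (let m = nat \<lfloor>s\<rfloor>; \<theta> = frac s in
      ennreal_sqrt (
        (\<Sum>\<alpha> | sum \<alpha> UNIV \<le> m. (L2_norm_on \<Omega> (weak_deriv \<Omega> \<alpha> f))\<^sup>2)
        + (if \<theta> = 0 then 0
           else \<Sum>\<alpha> | sum \<alpha> UNIV = m. gagliardo_sq \<theta> \<Omega> (weak_deriv \<Omega> \<alpha> f))))"

lemma finite_multi_indices: "finite {\<alpha> :: 'd::finite \<Rightarrow> nat. sum \<alpha> UNIV \<le> m}"
proof -
  have "finite {f :: 'd \<Rightarrow> nat. \<forall>i. (i \<in> UNIV \<longrightarrow> f i \<in> {..m}) \<and> (i \<notin> UNIV \<longrightarrow> f i = 0)}"
    by (rule finite_set_of_finite_funs; rule finite finite_atMost)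
  moreover have "f i \<le> m" if "sum f UNIV \<le> m" for f :: "'d \<Rightarrow> nat" and i
    by (rule order_trans[OF _ that], rule member_le_sum) (rule UNIV_I zero_le finite)+
  ultimately show ?thesis
    by (elim rev_finite_subset) blast
qed

definition sobolev_space ::
  "real \<Rightarrow> (real^'d::finite) set \<Rightarrow> (real^'d \<Rightarrow> real) set" where
  "sobolev_space s \<Omega> =
     {f. in_L2 \<Omega> f
       \<and> (\<forall>\<alpha>. sum \<alpha> UNIV \<le> nat \<lfloor>s\<rfloor> \<longrightarrow> (\<exists>g. in_L2 \<Omega> g \<and> weak_derivative_on \<Omega> \<alpha> f g))
       \<and> sobolev_norm s \<Omega> f < \<top>}"

definition sobolev_space0 ::
  "real \<Rightarrow> (real^'d::finite) set \<Rightarrow> (real^'d \<Rightarrow> real) set" where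
  "sobolev_space0 s \<Omega> =
     {f \<in> sobolev_space s \<Omega>.
        \<forall>\<epsilon>>0. \<exists>\<phi> \<in> test_functions \<Omega>. sobolev_norm s \<Omega> (\<lambda>x. f x - \<phi> x) < ennreal \<epsilon>}"

text \<open>The ball \<open>\<F>(s,R)\<close> of \<open>H^s_0(\<Omega>)\<close>. It is used for \<open>s > d/2\<close> only, where each class has a
  unique representative that is continuous on the closure of \<open>\<Omega>\<close>; this representative is the one
  evaluated at the sampling points.\<close>

definition sobolev_ball ::
  "real \<Rightarrow> real \<Rightarrow> (real^'d::finite) set \<Rightarrow> (real^'d \<Rightarrow> real) set" where
  "sobolev_ball s R \<Omega> =
     {f \<in> sobolev_space0 s \<Omega>.
        continuous_on (closure \<Omega>) f \<and> sobolev_norm s \<Omega> f \<le> ennreal R}"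

section \<open>Comparison up to constants\<close>

definition lesssim_on :: "'i set \<Rightarrow> ('i \<Rightarrow> ennreal) \<Rightarrow> ('i \<Rightarrow> ennreal) \<Rightarrow> bool" where
  "lesssim_on I u v \<longleftrightarrow> (\<exists>C::real. C > 0 \<and> (\<forall>i\<in>I. u i \<le> ennreal C * v i))"

definition sim_on :: "'i set \<Rightarrow> ('i \<Rightarrow> ennreal) \<Rightarrow> ('i \<Rightarrow> ennreal) \<Rightarrow> bool" where
  "sim_on I u v \<longleftrightarrow> lesssim_on I u v \<and> lesssim_on I v u"

section \<open>Sampling, reconstruction and regularisation\<close>

text \<open>For fixed \<open>n\<close>, the sampling points \<open>x\<close> and the functions \<open>\<phi>\<close> are indexed by
  \<open>{1..n}\<close>; vectors of length \<open>n\<close> are functions on \<^typ>\<open>nat\<close> of which only the values on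
  \<open>{1..n}\<close> are used.\<close>

definition sample :: "(nat \<Rightarrow> real^'d::finite) \<Rightarrow> (real^'d \<Rightarrow> real) \<Rightarrow> nat \<Rightarrow> real" where
  "sample x f i = f (x i)"

definition reconstruct ::
  "nat \<Rightarrow> (nat \<Rightarrow> real^'d::finite \<Rightarrow> real) \<Rightarrow> (nat \<Rightarrow> real) \<Rightarrow> real^'d \<Rightarrow> real" where
  "reconstruct n \<phi> z = (\<lambda>y. \<Sum>i=1..n. z i * \<phi> i y)"

definition scaled_kernel ::
  "(real^'d::finite \<Rightarrow> real) \<Rightarrow> real \<Rightarrow> real^'d \<Rightarrow> real" where
  "scaled_kernel K \<beta> x = K (x /\<^sub>R \<beta>) / \<beta> ^ CARD('d)"

definition regularise ::
  "(real^'d::finite) set \<Rightarrow> (real^'d \<Rightarrow> real) \<Rightarrow> real \<Rightarrow> (real^'d \<Rightarrow> real) \<Rightarrow> real^'d \<Rightarrow> real" where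
  "regularise \<Omega> K \<beta> g x = (LINT y:\<Omega>|lborel. scaled_kernel K \<beta> (x - y) * g y)"

definition kernel_moment :: "(real^'d::finite \<Rightarrow> real) \<Rightarrow> ('d \<Rightarrow> nat) \<Rightarrow> real" where
  "kernel_moment K r = (LINT x|lborel. (\<Prod>j\<in>UNIV. (x $ j) ^ r j) * K x)"

definition standard_noise :: "'w measure \<Rightarrow> nat \<Rightarrow> (nat \<Rightarrow> 'w \<Rightarrow> real) \<Rightarrow> bool" where
  "standard_noise M n \<xi> \<longleftrightarrow>
     prob_space M
     \<and> prob_space.indep_vars M (\<lambda>_. borel) \<xi> {1..n}
     \<and> (\<forall>i\<in>{1..n}. integrable M (\<xi> i) \<and> integrable M (\<lambda>\<omega>. (\<xi> i \<omega>)\<^sup>2)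
          \<and> prob_space.expectation M (\<xi> i) = 0 \<and> prob_space.variance M (\<xi> i) = 1)"

text \<open>The error \<open>e(\<beta>,\<sigma>,n)\<close>, with \<open>x\<close>, \<open>\<phi>\<close>, \<open>\<xi>\<close> the points, functions and noise variables
  for the given \<open>n\<close>.\<close>

definition recon_error ::
  "(real^'d::finite) set \<Rightarrow> (real^'d \<Rightarrow> real) \<Rightarrow> real \<Rightarrow> real
    \<Rightarrow> (nat \<Rightarrow> real^'d) \<Rightarrow> (nat \<Rightarrow> real^'d \<Rightarrow> real) \<Rightarrow> 'w measure \<Rightarrow> (nat \<Rightarrow> 'w \<Rightarrow> real)
    \<Rightarrow> real \<Rightarrow> real \<Rightarrow> nat \<Rightarrow> ennreal" where
  "recon_error \<Omega> K s R x \<phi> M \<xi> \<beta> \<sigma> n =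
     (SUP f \<in> sobolev_ball s R \<Omega>.
        ennreal_sqrt (\<integral>\<^sup>+\<omega>.
          (L2_norm_on \<Omega> (\<lambda>y.
             regularise \<Omega> K \<beta> (reconstruct n \<phi> (\<lambda>i. sample x f i + \<sigma> * \<xi> i \<omega>)) y - f y))\<^sup>2
          \<partial>M))"

end

theory Submission
  imports Defs
begin

text \<open>Writing the data as exact samples plus noise splits the error into three parts: the
  regularised approximation error \<open>K\<^sub>\<beta> * (P\<^sub>n E\<^sub>n f - f)\<close>, the regularisation error
  \<open>K\<^sub>\<beta> * f - f\<close>, and the noise \<open>\<sigma> \<Sum>\<^sub>i \<xi>\<^sub>i K\<^sub>\<beta> * \<phi>\<^sub>i\<close>. The second is controlled by hypothesis and the
  first by Young's inequality, since the \<open>L\<^sup>1\<close> norm of \<open>K\<^sub>\<beta>\<close> does not depend on \<open>\<beta>\<close>. For the third,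
  independence and Fubini give the expected square \<open>\<sigma>\<^sup>2 \<Sum>\<^sub>i \<parallel>K\<^sub>\<beta> * \<phi>\<^sub>i\<parallel>\<^sup>2\<close>, and each of the \<open>n\<close> summands is
  bounded by Young's inequality in both ways: \<open>\<parallel>K\<parallel>\<^sub>1\<^sup>2 \<parallel>\<phi>\<^sub>i\<parallel>\<^sub>2\<^sup>2\<close>, of order \<open>1/n\<close>, and
  \<open>\<parallel>K\<^sub>\<beta>\<parallel>\<^sub>2\<^sup>2 \<parallel>\<phi>\<^sub>i\<parallel>\<^sub>1\<^sup>2\<close>, of order \<open>\<beta>\<^sup>-\<^sup>d / n\<^sup>2\<close>.
  The bounds on the infimum come from choosing \<open>\<beta>\<close> with \<open>\<beta>\<^sup>r = \<sigma>\<close> for small noise, and by balancing the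
  noise term with \<open>\<beta>\<^sup>r\<close> otherwise, where \<open>r = s\<^sub>r\<close>.\<close>

section \<open>Square roots in \<open>ennreal\<close> and squared norms\<close>

lemma ennreal_sqrt_power2: "(ennreal_sqrt u)\<^sup>2 = u"
  by (cases u) (auto simp: ennreal_sqrt_def ennreal_power)

text \<open>For finite \<open>v\<close> this is monotonicity of the real root. It reduces a bound on
  the error to one on the mean square.\<close>

lemma ennreal_sqrt_le: assumes "u \<le> v\<^sup>2" shows "ennreal_sqrt u \<le> v"
proof (cases v)
  case (real r)
  then obtain t where t: "u = ennreal t" "t \<ge> 0"
    using assms by (cases u) (auto simp: ennreal_power top_unique)
  then have "t \<le> r\<^sup>2" using assms real by (simp add: ennreal_power)
  then have "sqrt t \<le> r" using real by (simp add: real_le_lsqrt)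
  then show ?thesis using t real by (simp add: ennreal_sqrt_def ennreal_leI)
qed simp

lemma L2_norm_on_power2:
  "(L2_norm_on \<Omega> g)\<^sup>2 = (\<integral>\<^sup>+x\<in>\<Omega>. ennreal ((g x)\<^sup>2) \<partial>lborel)"
  by (simp add: L2_norm_on_def ennreal_sqrt_power2)

section \<open>Changes of variables and Young's inequality on the whole space\<close>

text \<open>The power of \<open>\<bar>c\<bar>\<close> is the Jacobian. The cases
  \<open>c = -1\<close>, \<open>c = 1\<close> and \<open>c = \<beta>\<close> serve for reflection,
  translation and dilation.\<close>

lemma nn_integral_lborel_affine:
  fixes f :: "'a::euclidean_space \<Rightarrow> ennreal"
  assumes [measurable]: "f \<in> borel_measurable borel" and c: "c \<noteq> 0"
  shows "(\<integral>\<^sup>+x. f x \<partial>lborel) = ennreal (\<bar>c\<bar> ^ DIM('a)) * (\<integral>\<^sup>+x. f (t + c *\<^sub>R x) \<partial>lborel)"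
  by (subst lborel_affine[OF c, of t])
     (simp add: nn_integral_density nn_integral_distr nn_integral_cmult ennreal_power)

lemma nn_integral_lborel_reflect:
  fixes f :: "'a::euclidean_space \<Rightarrow> ennreal"
  assumes [measurable]: "f \<in> borel_measurable borel"
  shows "(\<integral>\<^sup>+y. f (x - y) \<partial>lborel) = (\<integral>\<^sup>+y. f y \<partial>lborel)"
  using nn_integral_lborel_affine[of f "-1" x] by simp

lemma nn_integral_lborel_translate:
  fixes f :: "'a::euclidean_space \<Rightarrow> ennreal"
  assumes [measurable]: "f \<in> borel_measurable borel"
  shows "(\<integral>\<^sup>+x. f (x - y) \<partial>lborel) = (\<integral>\<^sup>+x. f x \<partial>lborel)"
  using nn_integral_lborel_affine[of f 1 "-y"] by simp

text \<open>Cauchy--Schwarz is applied with respect to the measure with density \<^term>\<open>k\<close>.\<close>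

lemma convolution_L1_L2:
  fixes k g :: "'a::euclidean_space \<Rightarrow> ennreal"
  assumes [measurable]: "k \<in> borel_measurable borel" "g \<in> borel_measurable borel"
  shows "(\<integral>\<^sup>+x. (\<integral>\<^sup>+y. k y * g (x - y) \<partial>lborel)\<^sup>2 \<partial>lborel)
    \<le> (\<integral>\<^sup>+x. k x \<partial>lborel)\<^sup>2 * (\<integral>\<^sup>+x. (g x)\<^sup>2 \<partial>lborel)"
proof -
  let ?I = "\<integral>\<^sup>+x. k x \<partial>lborel"
  have "(\<integral>\<^sup>+y. k y * g (x - y) \<partial>lborel)\<^sup>2 \<le> ?I * (\<integral>\<^sup>+y. k y * (g (x - y))\<^sup>2 \<partial>lborel)" for x
    using Cauchy_Schwarz_nn_integral[of "\<lambda>_. 1" "density lborel k" "\<lambda>y. g (x - y)"]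
    by (simp add: nn_integral_density emeasure_density)
  then have "(\<integral>\<^sup>+x. (\<integral>\<^sup>+y. k y * g (x - y) \<partial>lborel)\<^sup>2 \<partial>lborel)
      \<le> (\<integral>\<^sup>+x. ?I * (\<integral>\<^sup>+y. k y * (g (x - y))\<^sup>2 \<partial>lborel) \<partial>lborel)"
    by (intro nn_integral_mono) auto
  also have "\<dots> = ?I * (\<integral>\<^sup>+x. (\<integral>\<^sup>+y. k y * (g (x - y))\<^sup>2 \<partial>lborel) \<partial>lborel)"
    by (simp add: nn_integral_cmult)
  \<comment> \<open>By Tonelli the inner integral runs over \<open>x\<close> for fixed
    \<open>y\<close>, where translation invariance removes the shift.\<close>
  also have "(\<integral>\<^sup>+x. (\<integral>\<^sup>+y. k y * (g (x - y))\<^sup>2 \<partial>lborel) \<partial>lborel)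
      = (\<integral>\<^sup>+y. (\<integral>\<^sup>+x. k y * (g (x - y))\<^sup>2 \<partial>lborel) \<partial>lborel)"
    by (rule lborel_pair.Fubini') simp
  also have "\<dots> = (\<integral>\<^sup>+y. k y * (\<integral>\<^sup>+x. (g x)\<^sup>2 \<partial>lborel) \<partial>lborel)"
    by (simp add: nn_integral_cmult nn_integral_lborel_translate[of "\<lambda>x. (g x)\<^sup>2"])
  also have "\<dots> = ?I * (\<integral>\<^sup>+x. (g x)\<^sup>2 \<partial>lborel)"
    by (simp add: nn_integral_multc)
  finally show ?thesis
    by (simp add: power2_eq_square mult.assoc)
qed

lemma nn_integral_convolution_commute:
  fixes k g :: "'a::euclidean_space \<Rightarrow> ennreal"
  assumes [measurable]: "k \<in> borel_measurable borel" "g \<in> borel_measurable borel"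
  shows "(\<integral>\<^sup>+y. k (x - y) * g y \<partial>lborel) = (\<integral>\<^sup>+y. k y * g (x - y) \<partial>lborel)"
  using nn_integral_lborel_reflect[of "\<lambda>y. k (x - y) * g y" x] by simp

text \<open>Convolution is symmetric, so \<open>convolution_L1_L2\<close> applies with the roles of
  \<open>k\<close> and \<open>g\<close> exchanged.\<close>

lemma convolution_L2_L1:
  fixes k g :: "'a::euclidean_space \<Rightarrow> ennreal"
  assumes [measurable]: "k \<in> borel_measurable borel" "g \<in> borel_measurable borel"
  shows "(\<integral>\<^sup>+x. (\<integral>\<^sup>+y. k y * g (x - y) \<partial>lborel)\<^sup>2 \<partial>lborel)
    \<le> (\<integral>\<^sup>+x. (k x)\<^sup>2 \<partial>lborel) * (\<integral>\<^sup>+x. g x \<partial>lborel)\<^sup>2"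
proof -
  have "(\<integral>\<^sup>+y. k y * g (x - y) \<partial>lborel) = (\<integral>\<^sup>+y. g y * k (x - y) \<partial>lborel)" for x
    using nn_integral_convolution_commute[of k g x] by (simp only: assms mult.commute)
  then show ?thesis
    using convolution_L1_L2[of g k] by (simp only: assms mult.commute)
qed

section \<open>Continuity, integrability and scaling of the kernel\<close>

lemma smooth_fun_continuous: assumes "smooth_fun f" shows "continuous_on A f"
proof -
  have "f differentiable (at x)" for x
    using assms[unfolded smooth_fun_def, rule_format, of "[]" x] by simp
  then show ?thesis
    by (meson continuous_at_imp_continuous_on differentiable_imp_continuous_within)
qed

text \<open>A continuous function is integrable over a compact set, and off the support the
  integrand vanishes because \<open>p > 0\<close> excludes \<open>0 ^ 0\<close>. The cases
  \<open>p = 1\<close> and \<open>p = 2\<close> make both norms of the kernel finite.\<close>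

lemma nn_integral_compact_support_finite:
  fixes f :: "real^'d::finite \<Rightarrow> real"
  assumes f: "continuous_on UNIV f" "compact (tsupport f)" and p: "p > 0"
  shows "(\<integral>\<^sup>+x. ennreal (\<bar>f x\<bar> ^ p) \<partial>lborel) < \<top>"
proof -
  have "integrable lborel (\<lambda>x. indicator (tsupport f) x *\<^sub>R \<bar>f x\<bar> ^ p)"
    using f by (intro borel_integrable_compact) (auto intro!: continuous_intros elim: continuous_on_subset)
  moreover have "f x = 0" if "x \<notin> tsupport f" for x
    using that closure_subset[of "{x. f x \<noteq> 0}"] by (auto simp: tsupport_def)
  then have "(\<lambda>x. indicator (tsupport f) x *\<^sub>R \<bar>f x\<bar> ^ p) = (\<lambda>x. \<bar>f x\<bar> ^ p)"
    using p by (auto simp: fun_eq_iff indicator_def)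
  ultimately have "integrable lborel (\<lambda>x. \<bar>f x\<bar> ^ p)"
    by (simp only:)
  then show ?thesis
    by (simp add: integrable_iff_bounded)
qed

context
  fixes K :: "real^'d::finite \<Rightarrow> real"
  assumes K_cont: "continuous_on UNIV K"
begin

lemma K_borel [measurable]: "K \<in> borel_measurable borel"
  using K_cont by (rule borel_measurable_continuous_onI)

lemma scaled_kernel_borel [measurable]: "scaled_kernel K \<beta> \<in> borel_measurable borel"
  unfolding scaled_kernel_def[abs_def] by measurable

lemma continuous_scaled_kernel: "continuous_on A (\<lambda>y. scaled_kernel K \<beta> (x - y))"
  unfolding scaled_kernel_def
  \<comment> \<open>At \<open>\<beta> = 0\<close> division by zero makes the function constantly
    \<open>0\<close>.\<close>
  by (cases "\<beta> = 0") (auto intro!: continuous_intros continuous_on_compose2[OF K_cont])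

text \<open>The Jacobian of the dilation by \<open>\<beta>\<close> cancels the normalising factor
  exactly.\<close>

lemma nn_integral_scaled_kernel:
  assumes "\<beta> > 0"
  shows "(\<integral>\<^sup>+x. ennreal \<bar>scaled_kernel K \<beta> x\<bar> \<partial>lborel) = (\<integral>\<^sup>+x. ennreal \<bar>K x\<bar> \<partial>lborel)"
proof -
  have "(\<integral>\<^sup>+x. ennreal \<bar>scaled_kernel K \<beta> x\<bar> \<partial>lborel)
      = ennreal (\<beta> ^ CARD('d)) * (\<integral>\<^sup>+x. ennreal (\<bar>K x\<bar> / \<beta> ^ CARD('d)) \<partial>lborel)"
    using assms by (subst nn_integral_lborel_affine[where c=\<beta> and t=0]) (auto simp: scaled_kernel_def)
  also have "\<dots> = (\<integral>\<^sup>+x. ennreal (\<beta> ^ CARD('d)) * ennreal (\<bar>K x\<bar> / \<beta> ^ CARD('d)) \<partial>lborel)"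
    by (simp add: nn_integral_cmult)
  also have "\<dots> = (\<integral>\<^sup>+x. ennreal \<bar>K x\<bar> \<partial>lborel)"
    using assms by (simp add: ennreal_mult[symmetric])
  finally show ?thesis .
qed

text \<open>Squaring doubles the normalising factor and the Jacobian cancels only one copy. The
  other is the growth of the \<open>L2\<close> norm for small \<open>\<beta>\<close>.\<close>

lemma nn_integral_scaled_kernel_power2:
  assumes "\<beta> > 0"
  shows "(\<integral>\<^sup>+x. ennreal ((scaled_kernel K \<beta> x)\<^sup>2) \<partial>lborel)
    = ennreal (1 / \<beta> ^ CARD('d)) * (\<integral>\<^sup>+x. ennreal ((K x)\<^sup>2) \<partial>lborel)"
proof -
  have "(\<integral>\<^sup>+x. ennreal ((scaled_kernel K \<beta> x)\<^sup>2) \<partial>lborel)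
      = ennreal (\<beta> ^ CARD('d)) * (\<integral>\<^sup>+x. ennreal ((K x / \<beta> ^ CARD('d))\<^sup>2) \<partial>lborel)"
    using assms by (subst nn_integral_lborel_affine[where c=\<beta> and t=0]) (auto simp: scaled_kernel_def)
  also have "\<dots> = (\<integral>\<^sup>+x. ennreal (\<beta> ^ CARD('d)) * ennreal ((K x / \<beta> ^ CARD('d))\<^sup>2) \<partial>lborel)"
    by (simp add: nn_integral_cmult)
  also have "\<dots> = (\<integral>\<^sup>+x. ennreal (1 / \<beta> ^ CARD('d)) * ennreal ((K x)\<^sup>2) \<partial>lborel)"
    using assms by (simp add: ennreal_mult[symmetric] power2_eq_square)
  finally show ?thesis
    by (simp add: nn_integral_cmult)
qed

section \<open>The regularisation operator: norm bounds and measurability\<close>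

text \<open>The absolute value moves under the integral and \<open>g\<close> is extended by zero
  outside \<open>\<Omega>\<close>, which leaves a convolution on the whole space.\<close>

lemma regularise_power2_le:
  "ennreal ((regularise \<Omega> K \<beta> g x)\<^sup>2)
    \<le> (\<integral>\<^sup>+y. ennreal \<bar>scaled_kernel K \<beta> (x - y)\<bar> * (ennreal \<bar>g y\<bar> * indicator \<Omega> y) \<partial>lborel)\<^sup>2"
proof -
  have "ennreal \<bar>regularise \<Omega> K \<beta> g x\<bar>
      \<le> (\<integral>\<^sup>+y. ennreal (norm (indicator \<Omega> y *\<^sub>R (scaled_kernel K \<beta> (x - y) * g y))) \<partial>lborel)"
  proof (cases "set_integrable lborel \<Omega> (\<lambda>y. scaled_kernel K \<beta> (x - y) * g y)")
    case True
    then show ?thesis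
      using integral_norm_bound_ennreal unfolding regularise_def set_lebesgue_integral_def set_integrable_def
      by fastforce
  \<comment> \<open>Without integrability the Bochner integral has the default value
    \<open>0\<close>.\<close>
  qed (simp add: regularise_def set_lebesgue_integral_def set_integrable_def not_integrable_integral_eq)
  also have "\<dots> = (\<integral>\<^sup>+y. ennreal \<bar>scaled_kernel K \<beta> (x - y)\<bar> * (ennreal \<bar>g y\<bar> * indicator \<Omega> y) \<partial>lborel)"
    by (intro nn_integral_cong) (auto simp: indicator_def abs_mult ennreal_mult)
  finally have "(ennreal \<bar>regularise \<Omega> K \<beta> g x\<bar>)\<^sup>2
    \<le> (\<integral>\<^sup>+y. ennreal \<bar>scaled_kernel K \<beta> (x - y)\<bar> * (ennreal \<bar>g y\<bar> * indicator \<Omega> y) \<partial>lborel)\<^sup>2"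
    by (rule power_mono) simp
  then show ?thesis
    by (simp add: ennreal_power)
qed

lemma indicator_abs_borel:
  assumes "set_borel_measurable lborel \<Omega> g"
  shows "(\<lambda>y. ennreal \<bar>g y\<bar> * indicator \<Omega> y) \<in> borel_measurable borel"
proof -
  have [measurable]: "(\<lambda>y. indicator \<Omega> y *\<^sub>R g y) \<in> borel_measurable borel"
    using assms by (simp add: set_borel_measurable_def)
  have "(\<lambda>y. ennreal \<bar>indicator \<Omega> y *\<^sub>R g y\<bar>) \<in> borel_measurable borel"
    by measurable
  also have "(\<lambda>y. ennreal \<bar>indicator \<Omega> y *\<^sub>R g y\<bar>) = (\<lambda>y. ennreal \<bar>g y\<bar> * indicator \<Omega> y)"
    by (auto simp: fun_eq_iff indicator_def)
  finally show ?thesis .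
qed

text \<open>The outer integral is enlarged from \<open>\<Omega>\<close> to the whole space, so that
  both forms of Young's inequality apply to the right-hand side.\<close>

lemma regularise_L2_le:
  assumes "set_borel_measurable lborel \<Omega> g"
  shows "(L2_norm_on \<Omega> (regularise \<Omega> K \<beta> g))\<^sup>2
    \<le> (\<integral>\<^sup>+x. (\<integral>\<^sup>+y. ennreal \<bar>scaled_kernel K \<beta> y\<bar> *
         (ennreal \<bar>g (x - y)\<bar> * indicator \<Omega> (x - y)) \<partial>lborel)\<^sup>2 \<partial>lborel)"
proof -
  have "(L2_norm_on \<Omega> (regularise \<Omega> K \<beta> g))\<^sup>2
    \<le> (\<integral>\<^sup>+x. ennreal ((regularise \<Omega> K \<beta> g x)\<^sup>2) \<partial>lborel)"
    unfolding L2_norm_on_power2 by (intro nn_integral_mono) (auto simp: indicator_def)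
  also have "\<dots> \<le> (\<integral>\<^sup>+x. (\<integral>\<^sup>+y. ennreal \<bar>scaled_kernel K \<beta> (x - y)\<bar> *
         (ennreal \<bar>g y\<bar> * indicator \<Omega> y) \<partial>lborel)\<^sup>2 \<partial>lborel)"
    by (intro nn_integral_mono regularise_power2_le)
  finally show ?thesis
    using indicator_abs_borel[OF assms]
    by (subst (asm) nn_integral_convolution_commute[of "\<lambda>y. ennreal \<bar>scaled_kernel K \<beta> y\<bar>"]) auto
qed

text \<open>Young's inequality with the \<open>L1\<close> norm of the kernel, which does not see
  \<open>\<beta>\<close>. It serves for the approximation error, and for the noise when
  \<open>\<beta>\<close> is below \<open>n powr (-1/d)\<close>.\<close>

lemma regularise_L2_L2:
  assumes "set_borel_measurable lborel \<Omega> g" "\<beta> > 0"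
  shows "(L2_norm_on \<Omega> (regularise \<Omega> K \<beta> g))\<^sup>2
    \<le> (\<integral>\<^sup>+x. ennreal \<bar>K x\<bar> \<partial>lborel)\<^sup>2 * (L2_norm_on \<Omega> g)\<^sup>2"
proof -
  have "(\<integral>\<^sup>+x. (ennreal \<bar>g x\<bar> * indicator \<Omega> x)\<^sup>2 \<partial>lborel) = (L2_norm_on \<Omega> g)\<^sup>2"
    unfolding L2_norm_on_power2
    by (intro nn_integral_cong) (auto simp: indicator_def ennreal_power)
  then show ?thesis
    using regularise_L2_le[OF assms(1), of \<beta>] indicator_abs_borel[OF assms(1)]
      convolution_L1_L2[of "\<lambda>x. ennreal \<bar>scaled_kernel K \<beta> x\<bar>" "\<lambda>x. ennreal \<bar>g x\<bar> * indicator \<Omega> x"]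
    by (simp add: nn_integral_scaled_kernel[OF assms(2)])
qed

text \<open>Young's inequality with the \<open>L2\<close> norm of the kernel. It serves for the
  noise when \<open>\<beta>\<close> is at least \<open>n powr (-1/d)\<close>: the basis functions
  are concentrated, so their \<open>L1\<close> norms are much smaller than their \<open>L2\<close>
  norms.\<close>

lemma regularise_L2_L1:
  assumes "set_borel_measurable lborel \<Omega> g" "\<beta> > 0"
  shows "(L2_norm_on \<Omega> (regularise \<Omega> K \<beta> g))\<^sup>2
    \<le> ennreal (1 / \<beta> ^ CARD('d)) * (\<integral>\<^sup>+x. ennreal ((K x)\<^sup>2) \<partial>lborel) * (L1_norm_on \<Omega> g)\<^sup>2"
  using regularise_L2_le[OF assms(1), of \<beta>] indicator_abs_borel[OF assms(1)]
    convolution_L2_L1[of "\<lambda>x. ennreal \<bar>scaled_kernel K \<beta> x\<bar>" "\<lambda>x. ennreal \<bar>g x\<bar> * indicator \<Omega> x"]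
  by (simp add: nn_integral_scaled_kernel_power2[OF assms(2)] L1_norm_on_def ennreal_power)

text \<open>The integrand is continuous on the compact closure, hence integrable there. This
  justifies splitting the regularisation by linearity.\<close>

lemma set_integrable_kernel:
  assumes "open \<Omega>" "bounded \<Omega>" "continuous_on (closure \<Omega>) g"
  shows "set_integrable lborel \<Omega> (\<lambda>y. scaled_kernel K \<beta> (x - y) * g y)"
proof -
  have "set_integrable lborel (closure \<Omega>) (\<lambda>y. scaled_kernel K \<beta> (x - y) * g y)"
    unfolding set_integrable_def using assms
    by (intro borel_integrable_compact)
       (auto intro!: continuous_on_mult continuous_scaled_kernel simp: compact_closure)
  then show ?thesis
    by (rule set_integrable_subset) (use assms(1) closure_subset in auto)
qed

text \<open>With \<open>g\<close> extended by zero the integrand is jointly Borel in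
  \<open>x\<close> and \<open>y\<close>, so the parameter integral is Borel in
  \<open>x\<close>.\<close>

lemma regularise_borel:
  assumes "open \<Omega>" "continuous_on \<Omega> g"
  shows "regularise \<Omega> K \<beta> g \<in> borel_measurable borel"
proof -
  have [measurable]: "(\<lambda>y. indicator \<Omega> y *\<^sub>R g y) \<in> borel_measurable borel"
    using assms by (intro borel_measurable_continuous_on_indicator) auto
  have "regularise \<Omega> K \<beta> g = (\<lambda>x. LINT y|lborel. scaled_kernel K \<beta> (x - y) * (indicator \<Omega> y *\<^sub>R g y))"
    by (auto simp: regularise_def set_lebesgue_integral_def fun_eq_iff algebra_simps)
  also have "\<dots> \<in> borel_measurable borel"
    by measurable
  finally show ?thesis .
qed

end

section \<open>Second moments of weighted noise\<close>

text \<open>Independence and mean zero remove the mixed terms of the expanded square, and unit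
  variance normalises the diagonal ones.\<close>

lemma second_moment_noise:
  assumes "standard_noise M n \<xi>"
  shows "(\<integral>\<^sup>+\<omega>. ennreal ((\<Sum>i=1..n. c i * \<xi> i \<omega>)\<^sup>2) \<partial>M) = ennreal (\<Sum>i=1..n. (c i)\<^sup>2)"
proof -
  interpret prob_space M using assms by (simp add: standard_noise_def)
  have iv: "indep_vars (\<lambda>_. borel) \<xi> {1..n}"
    and int: "\<And>i. i \<in> {1..n} \<Longrightarrow> integrable M (\<xi> i)"
    and sq: "\<And>i. i \<in> {1..n} \<Longrightarrow> integrable M (\<lambda>\<omega>. (\<xi> i \<omega>)\<^sup>2)"
    and mean: "\<And>i. i \<in> {1..n} \<Longrightarrow> expectation (\<xi> i) = 0"
    and var: "\<And>i. i \<in> {1..n} \<Longrightarrow> variance (\<xi> i) = 1"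
    using assms unfolding standard_noise_def by blast+
  have pair: "integrable M (\<lambda>\<omega>. \<xi> i \<omega> * \<xi> j \<omega>) \<and> expectation (\<lambda>\<omega>. \<xi> i \<omega> * \<xi> j \<omega>) = (if i = j then 1 else 0)"
    if ij: "i \<in> {1..n}" "j \<in> {1..n}" for i j
  proof (cases "i = j")
    case True
    have "variance (\<xi> i) = expectation (\<lambda>\<omega>. (\<xi> i \<omega>)\<^sup>2) - (expectation (\<xi> i))\<^sup>2"
      by (rule variance_eq) (use int sq ij in auto)
    then show ?thesis using True sq[OF ij(1)] mean[OF ij(1)] var[OF ij(1)]
      by (simp add: power2_eq_square)
  next
    case False
    \<comment> \<open>Independence of the pair factorises the expectation of the product, and one
      factor is \<open>0\<close>.\<close>
    have "indep_vars (\<lambda>_. borel) \<xi> {i, j}"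
      by (rule indep_vars_subset[OF iv]) (use ij in auto)
    then have "expectation (\<lambda>\<omega>. \<Prod>k\<in>{i, j}. \<xi> k \<omega>) = (\<Prod>k\<in>{i, j}. expectation (\<xi> k))"
      "integrable M (\<lambda>\<omega>. \<Prod>k\<in>{i, j}. \<xi> k \<omega>)"
      using int ij by (auto intro!: indep_vars_lebesgue_integral indep_vars_integrable)
    then show ?thesis using False mean[OF ij(1)] by simp
  qed
  have eq: "(\<Sum>i=1..n. c i * \<xi> i \<omega>)\<^sup>2 = (\<Sum>i=1..n. \<Sum>j=1..n. c i * c j * (\<xi> i \<omega> * \<xi> j \<omega>))" for \<omega>
    unfolding power2_eq_square sum_product by (intro sum.cong) auto
  have summand: "integrable M (\<lambda>\<omega>. c i * c j * (\<xi> i \<omega> * \<xi> j \<omega>))"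
    "expectation (\<lambda>\<omega>. c i * c j * (\<xi> i \<omega> * \<xi> j \<omega>)) = (if i = j then (c i)\<^sup>2 else 0)"
    if "i \<in> {1..n}" "j \<in> {1..n}" for i j
    using pair[OF that] by (auto simp: power2_eq_square)
  have int_row: "integrable M (\<lambda>\<omega>. \<Sum>j=1..n. c i * c j * (\<xi> i \<omega> * \<xi> j \<omega>))"
    if "i \<in> {1..n}" for i
    by (rule Bochner_Integration.integrable_sum) (rule summand(1)[OF that])
  have "integrable M (\<lambda>\<omega>. (\<Sum>i=1..n. c i * \<xi> i \<omega>)\<^sup>2)"
    unfolding eq by (rule Bochner_Integration.integrable_sum) (rule int_row)
  moreover have "expectation (\<lambda>\<omega>. (\<Sum>i=1..n. c i * \<xi> i \<omega>)\<^sup>2)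
      = (\<Sum>i=1..n. \<Sum>j=1..n. expectation (\<lambda>\<omega>. c i * c j * (\<xi> i \<omega> * \<xi> j \<omega>)))"
    unfolding eq using summand(1) int_row
    by (subst Bochner_Integration.integral_sum, blast)
      (intro sum.cong refl Bochner_Integration.integral_sum, blast)
  moreover have "\<dots> = (\<Sum>i=1..n. \<Sum>j=1..n. if i = j then (c i)\<^sup>2 else 0)"
    by (intro sum.cong refl summand(2))
  ultimately show ?thesis
    by (simp add: nn_integral_eq_integral)
qed

section \<open>Decomposition of the error and of its mean square\<close>

lemma continuous_on_reconstruct:
  assumes "\<And>i. i \<in> {1..n} \<Longrightarrow> continuous_on A (\<phi> i)"
  shows "continuous_on A (reconstruct n \<phi> z)"
  unfolding reconstruct_def using assms by (intro continuous_intros) auto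

lemma set_borel_measurable_closure:
  fixes g :: "real^'d::finite \<Rightarrow> real"
  assumes "open \<Omega>" "continuous_on (closure \<Omega>) g"
  shows "set_borel_measurable lborel \<Omega> g"
  unfolding set_borel_measurable_def
  using borel_measurable_continuous_on_indicator[OF _ continuous_on_subset[OF assms(2) closure_subset]] assms(1)
  by simp

text \<open>The right side exceeds the left by the sum of the squares of the pairwise
  differences.\<close>

lemma power2_sum3_le: "(a + b + c)\<^sup>2 \<le> 3 * a\<^sup>2 + 3 * b\<^sup>2 + 3 * (c::real)\<^sup>2"
proof -
  have "0 \<le> (a - b)\<^sup>2 + (b - c)\<^sup>2 + (a - c)\<^sup>2" by simp
  then show ?thesis by (simp add: power2_eq_square algebra_simps)
qed

context
  fixes K :: "real^'d::finite \<Rightarrow> real" and \<Omega> :: "(real^'d) set"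
  assumes K_cont: "continuous_on UNIV K" and \<Omega>: "open \<Omega>" "bounded \<Omega>"
begin

text \<open>Inside the regularisation \<open>f\<close> is subtracted and added again. Linearity of
  the integral then separates approximation, regularisation and noise.\<close>

lemma regularise_error_split:
  fixes \<phi> :: "nat \<Rightarrow> real^'d \<Rightarrow> real"
  assumes \<phi>: "\<And>i. i \<in> {1..n} \<Longrightarrow> continuous_on (closure \<Omega>) (\<phi> i)"
    and f: "continuous_on (closure \<Omega>) f"
  shows "regularise \<Omega> K \<beta> (reconstruct n \<phi> (\<lambda>i. sample x f i + \<sigma> * w i)) y - f y
    = regularise \<Omega> K \<beta> (\<lambda>y. reconstruct n \<phi> (sample x f) y - f y) y
      + (regularise \<Omega> K \<beta> f y - f y)
      + (\<Sum>i=1..n. (\<sigma> * regularise \<Omega> K \<beta> (\<phi> i) y) * w i)"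
proof -
  let ?k = "\<lambda>z. scaled_kernel K \<beta> (y - z)"
  let ?r = "\<lambda>z. reconstruct n \<phi> (sample x f) z - f z"
  have int: "set_integrable lborel \<Omega> (\<lambda>z. ?k z * g z)" if "continuous_on (closure \<Omega>) g" for g
    using set_integrable_kernel[OF K_cont \<Omega> that] .
  have r: "set_integrable lborel \<Omega> (\<lambda>z. ?k z * ?r z)"
    by (intro int continuous_on_diff continuous_on_reconstruct \<phi> f)
  have p: "set_integrable lborel \<Omega> (\<lambda>z. \<sigma> * w i * (?k z * \<phi> i z))" if "i \<in> {1..n}" for i
    using int[OF \<phi>[OF that]] by simp
  have s: "set_integrable lborel \<Omega> (\<lambda>z. \<Sum>i=1..n. \<sigma> * w i * (?k z * \<phi> i z))"
    using p unfolding set_integrable_def scaleR_sum_right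
    by (intro Bochner_Integration.integrable_sum) auto
  have "regularise \<Omega> K \<beta> (reconstruct n \<phi> (\<lambda>i. sample x f i + \<sigma> * w i)) y
      = (LINT z:\<Omega>|lborel. (?k z * ?r z + ?k z * f z) + (\<Sum>i=1..n. \<sigma> * w i * (?k z * \<phi> i z)))"
    unfolding regularise_def
    by (intro arg_cong[where f="set_lebesgue_integral lborel \<Omega>"])
      (auto simp: reconstruct_def fun_eq_iff algebra_simps sum.distrib sum_distrib_left)
  also have "\<dots> = regularise \<Omega> K \<beta> ?r y + regularise \<Omega> K \<beta> f y
      + (LINT z:\<Omega>|lborel. \<Sum>i=1..n. \<sigma> * w i * (?k z * \<phi> i z))"
    using r s int[OF f] by (simp add: regularise_def set_integral_add)
  also have "(LINT z:\<Omega>|lborel. \<Sum>i=1..n. \<sigma> * w i * (?k z * \<phi> i z))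
      = (\<Sum>i=1..n. LINT z:\<Omega>|lborel. \<sigma> * w i * (?k z * \<phi> i z))"
    using p unfolding set_lebesgue_integral_def set_integrable_def scaleR_sum_right
    by (intro Bochner_Integration.integral_sum) auto
  also have "\<dots> = (\<Sum>i=1..n. (\<sigma> * regularise \<Omega> K \<beta> (\<phi> i) y) * w i)"
    by (simp add: regularise_def mult_ac)
  finally show ?thesis by simp
qed

text \<open>The first two parts do not depend on \<open>\<omega>\<close>. In the third, Tonelli
  moves the expectation inside, where the second moment of the noise is known at each point.\<close>

lemma expected_error_le:
  fixes \<phi> :: "nat \<Rightarrow> real^'d \<Rightarrow> real"
  assumes \<phi>: "\<And>i. i \<in> {1..n} \<Longrightarrow> continuous_on (closure \<Omega>) (\<phi> i)"
    and f: "continuous_on (closure \<Omega>) f"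
    and noise: "standard_noise M n \<xi>"
  shows "(\<integral>\<^sup>+\<omega>. (L2_norm_on \<Omega> (\<lambda>y. regularise \<Omega> K \<beta>
            (reconstruct n \<phi> (\<lambda>i. sample x f i + \<sigma> * \<xi> i \<omega>)) y - f y))\<^sup>2 \<partial>M)
    \<le> 3 * (L2_norm_on \<Omega> (regularise \<Omega> K \<beta> (\<lambda>y. reconstruct n \<phi> (sample x f) y - f y)))\<^sup>2
      + 3 * (L2_norm_on \<Omega> (\<lambda>y. regularise \<Omega> K \<beta> f y - f y))\<^sup>2
      + 3 * (ennreal (\<sigma>\<^sup>2) * (\<Sum>i=1..n. (L2_norm_on \<Omega> (regularise \<Omega> K \<beta> (\<phi> i)))\<^sup>2))"
    (is "?lhs \<le> 3 * ?A + 3 * ?B + 3 * ?C")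
proof -
  interpret prob_space M using noise by (simp add: standard_noise_def)
  interpret pair_sigma_finite M "lborel :: (real^'d) measure" ..
  have \<xi>_meas: "\<xi> i \<in> borel_measurable M" if "i \<in> {1..n}" for i
    using noise that unfolding standard_noise_def by blast
  have \<Omega>_meas [measurable]: "\<Omega> \<in> sets borel" using \<Omega> by simp
  define a where "a = regularise \<Omega> K \<beta> (\<lambda>y. reconstruct n \<phi> (sample x f) y - f y)"
  \<comment> \<open>Continuity of \<open>f\<close> is given only on the closure. Its extension by
    zero is Borel on the whole space and agrees with \<open>f\<close> on
    \<open>\<Omega>\<close>.\<close>
  define f' where "f' = (\<lambda>y. indicator \<Omega> y *\<^sub>R f y)"
  define b where "b = (\<lambda>y. regularise \<Omega> K \<beta> f y - f' y)"
  define p where "p = (\<lambda>i. regularise \<Omega> K \<beta> (\<phi> i))"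
  define c where "c = (\<lambda>\<omega> y. \<Sum>i=1..n. (\<sigma> * p i y) * \<xi> i \<omega>)"
  have cont: "continuous_on \<Omega> g" if "continuous_on (closure \<Omega>) g" for g :: "real^'d \<Rightarrow> real"
    using continuous_on_subset[OF that closure_subset] .
  have [measurable]: "f' \<in> borel_measurable borel"
    unfolding f'_def using cont[OF f] \<Omega> by (intro borel_measurable_continuous_on_indicator) auto
  have a_meas [measurable]: "a \<in> borel_measurable borel"
    unfolding a_def by (intro regularise_borel[OF K_cont \<Omega>(1)] cont continuous_on_diff continuous_on_reconstruct \<phi> f)
  have f_meas [measurable]: "regularise \<Omega> K \<beta> f \<in> borel_measurable borel"
    by (intro regularise_borel[OF K_cont \<Omega>(1)] cont f)
  have b_meas [measurable]: "b \<in> borel_measurable borel"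
    unfolding b_def by measurable
  have p_meas [measurable]: "p i \<in> borel_measurable borel" if "i \<in> {1..n}" for i
    unfolding p_def by (intro regularise_borel[OF K_cont \<Omega>(1)] cont \<phi> that)
  have pp_meas: "(\<lambda>y. ennreal ((p i y)\<^sup>2) * indicator \<Omega> y) \<in> borel_measurable lborel"
    if "i \<in> {1..n}" for i
  proof -
    note [measurable] = p_meas[OF that]
    show ?thesis by measurable
  qed
  \<comment> \<open>Tonelli requires joint measurability. Each summand is a product of a function of
    \<open>y\<close> and a function of \<open>\<omega>\<close>.\<close>
  have c_meas [measurable]: "case_prod c \<in> borel_measurable (M \<Otimes>\<^sub>M lborel)"
  proof -
    have "(\<lambda>w. \<Sum>i=1..n. (\<sigma> * p i (snd w)) * \<xi> i (fst w)) \<in> borel_measurable (M \<Otimes>\<^sub>M lborel)"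
    proof (rule borel_measurable_sum)
      fix i assume i: "i \<in> {1..n}"
      note [measurable] = p_meas[OF i] \<xi>_meas[OF i]
      show "(\<lambda>w. (\<sigma> * p i (snd w)) * \<xi> i (fst w)) \<in> borel_measurable (M \<Otimes>\<^sub>M lborel)"
        by measurable
    qed
    moreover have "case_prod c = (\<lambda>w. \<Sum>i=1..n. (\<sigma> * p i (snd w)) * \<xi> i (fst w))"
      by (rule ext) (simp add: c_def split_beta)
    ultimately show ?thesis by (simp only:)
  qed
  have c_meas1: "c \<omega> \<in> borel_measurable lborel" if "\<omega> \<in> space M" for \<omega>
    using measurable_Pair2[OF c_meas that] by (simp only: prod.case)
  \<comment> \<open>For a fixed outcome the squared error splits at the cost of a factor
    \<open>3\<close>, and only the last term still depends on \<open>\<omega>\<close>.\<close>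
  have pointwise: "(L2_norm_on \<Omega> (\<lambda>y. regularise \<Omega> K \<beta>
      (reconstruct n \<phi> (\<lambda>i. sample x f i + \<sigma> * \<xi> i \<omega>)) y - f y))\<^sup>2
      \<le> 3 * ?A + 3 * ?B + 3 * (\<integral>\<^sup>+y\<in>\<Omega>. ennreal ((c \<omega> y)\<^sup>2) \<partial>lborel)" if \<omega>: "\<omega> \<in> space M" for \<omega>
  proof -
    note [measurable] = c_meas1[OF \<omega>]
    have eq: "regularise \<Omega> K \<beta> (reconstruct n \<phi> (\<lambda>i. sample x f i + \<sigma> * \<xi> i \<omega>)) y - f y
        = a y + b y + c \<omega> y" if "y \<in> \<Omega>" for y
      using regularise_error_split[OF \<phi> f, where w="\<lambda>i. \<xi> i \<omega>" and y=y] that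
      by (simp add: a_def b_def c_def p_def f'_def)
    have "(L2_norm_on \<Omega> (\<lambda>y. regularise \<Omega> K \<beta>
        (reconstruct n \<phi> (\<lambda>i. sample x f i + \<sigma> * \<xi> i \<omega>)) y - f y))\<^sup>2
        \<le> (\<integral>\<^sup>+y. 3 * (ennreal ((a y)\<^sup>2) * indicator \<Omega> y) + 3 * (ennreal ((b y)\<^sup>2) * indicator \<Omega> y)
            + 3 * (ennreal ((c \<omega> y)\<^sup>2) * indicator \<Omega> y) \<partial>lborel)"
      unfolding L2_norm_on_power2
    proof (intro nn_integral_mono)
      fix y
      have "ennreal ((a y + b y + c \<omega> y)\<^sup>2) \<le> ennreal (3 * (a y)\<^sup>2 + 3 * (b y)\<^sup>2 + 3 * (c \<omega> y)\<^sup>2)"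
        by (intro ennreal_leI power2_sum3_le)
      also have "\<dots> = 3 * ennreal ((a y)\<^sup>2) + 3 * ennreal ((b y)\<^sup>2) + 3 * ennreal ((c \<omega> y)\<^sup>2)"
        by (simp add: ennreal_mult)
      finally show "ennreal ((regularise \<Omega> K \<beta> (reconstruct n \<phi> (\<lambda>i. sample x f i + \<sigma> * \<xi> i \<omega>)) y - f y)\<^sup>2)
          * indicator \<Omega> y
        \<le> 3 * (ennreal ((a y)\<^sup>2) * indicator \<Omega> y) + 3 * (ennreal ((b y)\<^sup>2) * indicator \<Omega> y)
            + 3 * (ennreal ((c \<omega> y)\<^sup>2) * indicator \<Omega> y)"
        by (cases "y \<in> \<Omega>") (simp_all add: eq)
    qed
    also have "\<dots> = 3 * (\<integral>\<^sup>+y\<in>\<Omega>. ennreal ((a y)\<^sup>2) \<partial>lborel) + 3 * (\<integral>\<^sup>+y\<in>\<Omega>. ennreal ((b y)\<^sup>2) \<partial>lborel)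
        + 3 * (\<integral>\<^sup>+y\<in>\<Omega>. ennreal ((c \<omega> y)\<^sup>2) \<partial>lborel)"
      by (simp add: nn_integral_add nn_integral_cmult)
    also have "(\<integral>\<^sup>+y\<in>\<Omega>. ennreal ((b y)\<^sup>2) \<partial>lborel) = ?B"
      unfolding L2_norm_on_power2 by (intro nn_integral_cong) (auto simp: b_def f'_def indicator_def)
    finally show ?thesis
      by (simp add: L2_norm_on_power2 a_def)
  qed
  have cc_meas [measurable]:
    "(\<lambda>(\<omega>, y). ennreal ((c \<omega> y)\<^sup>2) * indicator \<Omega> y) \<in> borel_measurable (M \<Otimes>\<^sub>M lborel)"
  proof -
    have [measurable]: "(\<lambda>w. c (fst w) (snd w)) \<in> borel_measurable (M \<Otimes>\<^sub>M lborel)"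
      using c_meas by (simp only: case_prod_unfold)
    show ?thesis unfolding case_prod_unfold by measurable
  qed
  have "(\<integral>\<^sup>+\<omega>. (\<integral>\<^sup>+y\<in>\<Omega>. ennreal ((c \<omega> y)\<^sup>2) \<partial>lborel) \<partial>M)
      = (\<integral>\<^sup>+y. (\<integral>\<^sup>+\<omega>. ennreal ((c \<omega> y)\<^sup>2) * indicator \<Omega> y \<partial>M) \<partial>lborel)"
    by (rule Fubini'[symmetric]) (rule cc_meas)
  also have "\<dots> = (\<integral>\<^sup>+y. ennreal (\<sigma>\<^sup>2) * (\<Sum>i=1..n. ennreal ((p i y)\<^sup>2) * indicator \<Omega> y) \<partial>lborel)"
  proof (intro nn_integral_cong)
    fix y
    \<comment> \<open>With \<open>y\<close> fixed, the weights of the noise variables are the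
      numbers \<open>\<sigma> * p i y\<close>.\<close>
    have "(\<integral>\<^sup>+\<omega>. ennreal ((c \<omega> y)\<^sup>2) \<partial>M)
        = ennreal (\<sigma>\<^sup>2) * (\<Sum>i=1..n. ennreal ((p i y)\<^sup>2))"
      unfolding c_def second_moment_noise[OF noise]
      by (simp add: power_mult_distrib sum_distrib_left[symmetric] ennreal_mult sum_nonneg)
    then show "(\<integral>\<^sup>+\<omega>. ennreal ((c \<omega> y)\<^sup>2) * indicator \<Omega> y \<partial>M)
        = ennreal (\<sigma>\<^sup>2) * (\<Sum>i=1..n. ennreal ((p i y)\<^sup>2) * indicator \<Omega> y)"
      by (cases "y \<in> \<Omega>") auto
  qed
  also have "\<dots> = ennreal (\<sigma>\<^sup>2) * (\<Sum>i=1..n. \<integral>\<^sup>+y\<in>\<Omega>. ennreal ((p i y)\<^sup>2) \<partial>lborel)"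
    using pp_meas by (simp only: nn_integral_cmult nn_integral_sum borel_measurable_sum)
  also have "\<dots> = ?C"
    by (simp add: L2_norm_on_power2 p_def)
  finally have C: "(\<integral>\<^sup>+\<omega>. (\<integral>\<^sup>+y\<in>\<Omega>. ennreal ((c \<omega> y)\<^sup>2) \<partial>lborel) \<partial>M) = ?C" .
  have int_meas [measurable]: "(\<lambda>\<omega>. \<integral>\<^sup>+y\<in>\<Omega>. ennreal ((c \<omega> y)\<^sup>2) \<partial>lborel) \<in> borel_measurable M"
    by (rule lborel.borel_measurable_nn_integral) (rule cc_meas)
  have "?lhs \<le> (\<integral>\<^sup>+\<omega>. (3 * ?A + 3 * ?B) + 3 * (\<integral>\<^sup>+y\<in>\<Omega>. ennreal ((c \<omega> y)\<^sup>2) \<partial>lborel) \<partial>M)"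
    by (intro nn_integral_mono pointwise)
  also have "\<dots> = 3 * ?A + 3 * ?B + 3 * ?C"
    by (simp add: nn_integral_add nn_integral_cmult C emeasure_space_1 del: ennreal_plus)
  finally show ?thesis .
qed

section \<open>The noise carried by a single basis function\<close>

text \<open>The two forms of Young's inequality give bounds of order \<open>1 / n\<close> and
  \<open>\<beta>\<close> to the power \<open>-d\<close> over \<open>n\<close> squared. The minimum
  tells which one to use, and the constant adds the coefficients of both cases.\<close>

lemma noise_term_le:
  fixes \<phi> :: "real^'d \<Rightarrow> real" and C1 C2 C3 h k1 k2 :: real
  defines "d \<equiv> real CARD('d)"
  assumes \<phi>: "continuous_on (closure \<Omega>) \<phi>"
    and h: "0 < h" "h \<le> C1 * real n powr (- 1 / d)"
    and L2: "L2_norm_on \<Omega> \<phi> \<le> ennreal (C2 * h powr (d / 2))"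
    and L1: "L1_norm_on \<Omega> \<phi> \<le> ennreal (C3 * h powr d)"
    and k1: "(\<integral>\<^sup>+x. ennreal \<bar>K x\<bar> \<partial>lborel) = ennreal k1" "k1 \<ge> 0"
    and k2: "(\<integral>\<^sup>+x. ennreal ((K x)\<^sup>2) \<partial>lborel) = ennreal k2" "k2 \<ge> 0"
    and pos: "C1 > 0" "C2 > 0" "C3 > 0" "\<beta> > 0" "n \<ge> 1"
  shows "(L2_norm_on \<Omega> (regularise \<Omega> K \<beta> \<phi>))\<^sup>2
    \<le> ennreal ((k1\<^sup>2 * C2\<^sup>2 * C1 powr d + k2 * C3\<^sup>2 * (C1 powr d)\<^sup>2)
        * (min (inverse \<beta> * real n powr (- 1 / d)) 1 powr (d / 2))\<^sup>2 / real n)"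
proof -
  have d: "d > 0" by (simp add: d_def)
  have meas: "set_borel_measurable lborel \<Omega> \<phi>"
    using \<Omega>(1) \<phi> by (rule set_borel_measurable_closure)
  have "h powr d \<le> (C1 * real n powr (- 1 / d)) powr d"
    using h d by (intro powr_mono2) auto
  also have "\<dots> = C1 powr d / real n"
    using pos d by (simp add: powr_mult powr_divide powr_powr powr_minus_divide)
  finally have hd: "h powr d \<le> C1 powr d / real n" .
  have sq: "(t powr (d / 2))\<^sup>2 = t powr d" for t :: real
    by (simp add: power2_eq_square flip: powr_add)
  have D: "x / real n \<le> D * m / real n" if "x \<le> D * m" for x D m :: real
    using that pos by (intro divide_right_mono) auto
  show ?thesis
  proof (cases "inverse \<beta> * real n powr (- 1 / d) \<le> 1")
    \<comment> \<open>The minimum is \<open>1\<close>, so the bound uniform in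
      \<open>\<beta>\<close> is used.\<close>
    case False
    have "(L2_norm_on \<Omega> (regularise \<Omega> K \<beta> \<phi>))\<^sup>2 \<le> ennreal (k1\<^sup>2) * (ennreal (C2 * h powr (d / 2)))\<^sup>2"
      using regularise_L2_L2[OF K_cont meas pos(4)] power_mono[OF L2, of 2] k1
      by (auto simp: ennreal_power elim!: order_trans intro!: mult_left_mono)
    also have "\<dots> = ennreal (k1\<^sup>2 * C2\<^sup>2 * h powr d)"
      using pos by (simp add: ennreal_power ennreal_mult[symmetric] power_mult_distrib sq mult.assoc)
    also have "\<dots> \<le> ennreal (k1\<^sup>2 * C2\<^sup>2 * (C1 powr d / real n))"
      using hd by (intro ennreal_leI mult_left_mono) auto
    also have "\<dots> \<le> ennreal ((k1\<^sup>2 * C2\<^sup>2 * C1 powr d + k2 * C3\<^sup>2 * (C1 powr d)\<^sup>2) * 1 / real n)"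
      using k2 pos by (intro ennreal_leI) (simp add: divide_right_mono)
    also have "1 = (min (inverse \<beta> * real n powr (- 1 / d)) 1 powr (d / 2))\<^sup>2"
      using False by simp
    finally show ?thesis .
  next
    \<comment> \<open>Of the two factors \<open>1 / n\<close>, one joins the power of
      \<open>\<beta>\<close> to form the squared minimum and the other remains.\<close>
    case True
    have "(L2_norm_on \<Omega> (regularise \<Omega> K \<beta> \<phi>))\<^sup>2
        \<le> ennreal (1 / \<beta> ^ CARD('d)) * ennreal k2 * (ennreal (C3 * h powr d))\<^sup>2"
      using regularise_L2_L1[OF K_cont meas pos(4)] power_mono[OF L1, of 2] k2
      by (auto elim!: order_trans intro!: mult_left_mono)
    also have "\<dots> = ennreal (1 / \<beta> ^ CARD('d) * k2 * C3\<^sup>2 * (h powr d)\<^sup>2)"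
      using pos k2 by (simp add: ennreal_power ennreal_mult[symmetric] power_mult_distrib mult.assoc)
    also have "\<dots> \<le> ennreal (1 / \<beta> ^ CARD('d) * k2 * C3\<^sup>2 * (C1 powr d / real n)\<^sup>2)"
      using hd pos k2 by (intro ennreal_leI mult_left_mono power_mono) auto
    also have "\<dots> = ennreal (k2 * C3\<^sup>2 * (C1 powr d)\<^sup>2 * (inverse \<beta> powr d / real n) / real n)"
      using pos by (simp add: d_def powr_realpow power_divide power_inverse power2_eq_square field_simps)
    also have "\<dots> \<le> ennreal ((k1\<^sup>2 * C2\<^sup>2 * C1 powr d + k2 * C3\<^sup>2 * (C1 powr d)\<^sup>2)
        * (inverse \<beta> powr d / real n) / real n)"
      using k1 pos by (intro ennreal_leI divide_right_mono mult_right_mono) auto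
    also have "inverse \<beta> powr d / real n = (inverse \<beta> * real n powr (- 1 / d)) powr d"
      using pos d by (simp add: powr_mult powr_divide powr_powr powr_minus_divide)
    also have "\<dots> = (min (inverse \<beta> * real n powr (- 1 / d)) 1 powr (d / 2))\<^sup>2"
      unfolding sq using True by simp
    finally show ?thesis .
  qed
qed

end

section \<open>Choice of the regularisation parameter\<close>

text \<open>This \<open>\<beta>\<close> balances the noise term against \<open>\<beta>\<^sup>r\<close>.\<close>

lemma parameter_choice:
  fixes d :: real and r n :: nat
  assumes "d > 0" "r \<ge> 1" "n \<ge> 1" "\<sigma> > 0"
  defines "\<beta> \<equiv> (\<sigma> * real n powr (- 1 / 2)) powr (2 / (2 * real r + d))"
  shows "\<beta> > 0"
    and "\<beta> ^ r = \<sigma> powr (2 * real r / (2 * real r + d)) * real n powr (- real r / (2 * real r + d))"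
    and "\<sigma> * (inverse \<beta> * real n powr (- 1 / d)) powr (d / 2) = \<beta> ^ r"
proof -
  let ?q = "2 * real r + d"
  have q: "?q > 0" using assms by simp
  define t where "t = \<sigma> * real n powr (- 1 / 2)"
  have t: "t > 0" using assms by (simp add: t_def)
  show \<beta>: "\<beta> > 0" using assms by simp
  have \<beta>_t: "\<beta> = t powr (2 / ?q)"
    unfolding \<beta>_def t_def ..
  have \<beta>r: "\<beta> ^ r = t powr (2 * real r / ?q)"
    using \<beta> by (subst powr_realpow[symmetric]) (simp_all add: \<beta>_t powr_powr)
  then show "\<beta> ^ r = \<sigma> powr (2 * real r / ?q) * real n powr (- real r / ?q)"
    using assms by (simp add: t_def powr_mult powr_powr)
  \<comment> \<open>Raising \<open>n powr (-1/d)\<close> to the power \<open>d / 2\<close> gives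
    \<open>n powr (-1/2)\<close>, which is the factor contained in \<open>t\<close>.\<close>
  have "\<sigma> * (inverse \<beta> * real n powr (- 1 / d)) powr (d / 2) = t * inverse \<beta> powr (d / 2)"
    using assms \<beta> by (simp add: t_def powr_mult powr_powr)
  also have "\<dots> = t powr 1 * t powr (- (d / ?q))"
  proof -
    have "2 / c * (d / 2) = d / c" for c :: real by simp
    then have "\<beta> powr (d / 2) = t powr (d / ?q)"
      unfolding \<beta>_t powr_powr by (simp only:)
    then show ?thesis
      using t by (simp add: inverse_powr powr_minus)
  qed
  also have "\<dots> = t powr (1 - d / ?q)"
    by (subst powr_add[symmetric]) simp
  also have "1 - d / ?q = 2 * real r / ?q"
    using q by (simp add: field_simps)
  finally show "\<sigma> * (inverse \<beta> * real n powr (- 1 / d)) powr (d / 2) = \<beta> ^ r"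
    using \<beta>r by simp
qed

text \<open>Each square on the right has coefficient \<open>4\<close>, and the mixed terms are
  nonnegative. This gathers the three squared bounds under a single square.\<close>

lemma sum3_power2_le:
  fixes a b c :: real
  assumes "a \<ge> 0" "b \<ge> 0" "c \<ge> 0"
  shows "3 * a\<^sup>2 + 3 * b\<^sup>2 + 3 * c\<^sup>2 \<le> (2 * (a + b + c))\<^sup>2"
proof -
  have "(2 * (a + b + c))\<^sup>2 = 4 * a\<^sup>2 + 4 * b\<^sup>2 + 4 * c\<^sup>2 + 8 * (a * b) + 8 * (b * c) + 8 * (a * c)"
    by (simp add: power2_eq_square algebra_simps)
  moreover have "0 \<le> a * b" "0 \<le> b * c" "0 \<le> a * c" "0 \<le> a\<^sup>2" "0 \<le> b\<^sup>2" "0 \<le> c\<^sup>2"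
    using assms by simp_all
  ultimately show ?thesis by linarith
qed

lemma lesssim_onE:
  assumes "lesssim_on I u v"
  obtains C :: real where "C > 0" "\<And>i. i \<in> I \<Longrightarrow> u i \<le> ennreal C * v i"
  using assms by (auto simp: lesssim_on_def)

section \<open>The uniform error bound and the infimum over \<open>\<beta>\<close>\<close>

theorem theorem1:
  fixes \<Omega> :: "(real^'d::finite) set"
    and x :: "nat \<Rightarrow> nat \<Rightarrow> real^'d"
    and \<phi> :: "nat \<Rightarrow> nat \<Rightarrow> real^'d \<Rightarrow> real"
    and h :: "nat \<Rightarrow> real"
    and K :: "real^'d \<Rightarrow> real"
    and s\<^sub>a s R d :: real
    and s\<^sub>r :: nat
  defines "d \<equiv> real CARD('d)"
  assumes domain: "open \<Omega>" "bounded \<Omega>" "connected \<Omega>" "smooth_boundary \<Omega>"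
    and points: "\<And>n i. 1 \<le> i \<Longrightarrow> i \<le> n \<Longrightarrow> x n i \<in> closure \<Omega>"
    and phi_cont: "\<And>n i. 1 \<le> i \<Longrightarrow> i \<le> n \<Longrightarrow> continuous_on (closure \<Omega>) (\<phi> n i)"
    and h_pos: "\<And>n. n \<ge> 1 \<Longrightarrow> h n > 0"
    and h_sim: "sim_on {1..} (\<lambda>n. ennreal (h n)) (\<lambda>n. ennreal (real n powr (- 1 / d)))"
    and phi_L2: "sim_on {(n, i). 1 \<le> i \<and> i \<le> n}
          (\<lambda>(n, i). L2_norm_on \<Omega> (\<phi> n i)) (\<lambda>(n, i). ennreal (h n powr (d / 2)))"
    and phi_L1: "sim_on {(n, i). 1 \<le> i \<and> i \<le> n}
          (\<lambda>(n, i). L1_norm_on \<Omega> (\<phi> n i)) (\<lambda>(n, i). ennreal (h n powr d))"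
    and sa_pos: "s\<^sub>a > 0"
    and approx: "\<And>s R. s > d / 2 \<Longrightarrow> s \<ge> s\<^sub>a \<Longrightarrow> R > 0 \<Longrightarrow>
          sim_on {1..}
            (\<lambda>n. SUP f \<in> sobolev_ball s R \<Omega>.
               L2_norm_on \<Omega> (\<lambda>y. reconstruct n (\<phi> n) (sample (x n) f) y - f y))
            (\<lambda>n. ennreal (h n powr s\<^sub>a))"
    and K_smooth: "smooth_fun K"
    and K_supp: "compact (tsupport K)"
    and K_int: "(LINT y|lborel. K y) = 1"
    and sr_ge: "s\<^sub>r - 1 \<ge> 1"
    and K_moments: "\<And>r. 1 \<le> sum r UNIV \<Longrightarrow> sum r UNIV \<le> s\<^sub>r - 1 \<Longrightarrow> kernel_moment K r = 0"
    and K_moment_nz: "\<exists>r. sum r UNIV = s\<^sub>r \<and> kernel_moment K r \<noteq> 0"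
    and reg_upper: "\<And>s R. s > d / 2 \<Longrightarrow> s \<ge> real s\<^sub>r \<Longrightarrow> R > 0 \<Longrightarrow>
          lesssim_on {0<..}
            (\<lambda>\<beta>. SUP f \<in> sobolev_ball s R \<Omega>. L2_norm_on \<Omega> (\<lambda>y. regularise \<Omega> K \<beta> f y - f y))
            (\<lambda>\<beta>. ennreal (\<beta> ^ s\<^sub>r))"
    and reg_lower: "\<And>s R. s > d / 2 \<Longrightarrow> s \<ge> real s\<^sub>r \<Longrightarrow> R > 0 \<Longrightarrow>
          \<exists>\<beta>\<^sub>0>0. lesssim_on {0<..\<beta>\<^sub>0}
            (\<lambda>\<beta>. ennreal (\<beta> ^ s\<^sub>r))
            (\<lambda>\<beta>. SUP f \<in> sobolev_ball s R \<Omega>. L2_norm_on \<Omega> (\<lambda>y. regularise \<Omega> K \<beta> f y - f y))"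
    and s_gt: "s > d / 2"
    and s_ge: "s \<ge> max (real s\<^sub>r) s\<^sub>a"
    and R_pos: "R > 0"
  shows "(\<exists>C>0. \<forall>n\<ge>1. \<forall>(M :: 'w measure) \<xi>. standard_noise M n \<xi> \<longrightarrow>
            (\<forall>\<sigma>>0. \<forall>\<beta>>0.
               recon_error \<Omega> K s R (x n) (\<phi> n) M \<xi> \<beta> \<sigma> n
               \<le> ennreal (C * (\<sigma> * min (inverse \<beta> * real n powr (- 1 / d)) 1 powr (d / 2)
                               + real n powr (- s\<^sub>a / d) + \<beta> ^ s\<^sub>r))))
       \<and> (\<forall>A>0. \<exists>C\<^sub>A>0. \<forall>n\<ge>1. \<forall>(M :: 'w measure) \<xi>. standard_noise M n \<xi> \<longrightarrow>
            (\<forall>\<sigma>>0.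
               (INF \<beta> \<in> {0<..}. recon_error \<Omega> K s R (x n) (\<phi> n) M \<xi> \<beta> \<sigma> n)
               \<le> ennreal (if \<sigma> \<le> A * real n powr (- real s\<^sub>r / d)
                    then C\<^sub>A * (\<sigma> + real n powr (- s\<^sub>a / d))
                    else C\<^sub>A * (\<sigma> powr (2 * real s\<^sub>r / (2 * real s\<^sub>r + d))
                                 * real n powr (- real s\<^sub>r / (2 * real s\<^sub>r + d))
                               + real n powr (- s\<^sub>a / d)))))"
proof -
  let ?N = "\<lambda>n. real n powr (- 1 / d)"
  let ?m = "\<lambda>\<beta> n. min (inverse \<beta> * ?N n) 1 powr (d / 2)"
  have d_pos: "d > 0" by (simp add: d_def)
  have K_cont: "continuous_on UNIV K"
    using K_smooth by (rule smooth_fun_continuous)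
  have s_sa: "s \<ge> s\<^sub>a" and s_sr: "s \<ge> real s\<^sub>r"
    using s_ge by simp_all
  \<comment> \<open>The comparison hypotheses are turned into upper bounds with real constants,
    fixed before \<open>n\<close>, \<open>\<sigma>\<close> and \<open>\<beta>\<close>.\<close>
  obtain C1 where C1: "C1 > 0" "\<And>n. n \<ge> 1 \<Longrightarrow> h n \<le> C1 * ?N n"
  proof -
    obtain C where C: "C > 0" "\<And>n. n \<in> {1..} \<Longrightarrow> ennreal (h n) \<le> ennreal C * ennreal (?N n)"
      by (rule lesssim_onE[OF conjunct1[OF h_sim[unfolded sim_on_def]]]) (rule that)
    have "h n \<le> C * ?N n" if "n \<ge> 1" for n
      using C(2)[of n] that C(1) by (simp add: ennreal_mult[symmetric])
    then show ?thesis using that C(1) by blast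
  qed
  obtain C2 where C2: "C2 > 0"
    "\<And>n i. 1 \<le> i \<Longrightarrow> i \<le> n \<Longrightarrow> L2_norm_on \<Omega> (\<phi> n i) \<le> ennreal (C2 * h n powr (d / 2))"
  proof -
    obtain C where C: "C > 0" "\<And>p. p \<in> {(n, i). 1 \<le> i \<and> i \<le> n} \<Longrightarrow>
        (case p of (n, i) \<Rightarrow> L2_norm_on \<Omega> (\<phi> n i)) \<le> ennreal C * (case p of (n, i) \<Rightarrow> ennreal (h n powr (d / 2)))"
      by (rule lesssim_onE[OF conjunct1[OF phi_L2[unfolded sim_on_def]]]) (rule that)
    have "L2_norm_on \<Omega> (\<phi> n i) \<le> ennreal (C * h n powr (d / 2))" if "1 \<le> i" "i \<le> n" for n i
      using C(2)[of "(n, i)"] that C(1) by (simp add: ennreal_mult)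
    then show ?thesis using that C(1) by blast
  qed
  obtain C3 where C3: "C3 > 0"
    "\<And>n i. 1 \<le> i \<Longrightarrow> i \<le> n \<Longrightarrow> L1_norm_on \<Omega> (\<phi> n i) \<le> ennreal (C3 * h n powr d)"
  proof -
    obtain C where C: "C > 0" "\<And>p. p \<in> {(n, i). 1 \<le> i \<and> i \<le> n} \<Longrightarrow>
        (case p of (n, i) \<Rightarrow> L1_norm_on \<Omega> (\<phi> n i)) \<le> ennreal C * (case p of (n, i) \<Rightarrow> ennreal (h n powr d))"
      by (rule lesssim_onE[OF conjunct1[OF phi_L1[unfolded sim_on_def]]]) (rule that)
    have "L1_norm_on \<Omega> (\<phi> n i) \<le> ennreal (C * h n powr d)" if "1 \<le> i" "i \<le> n" for n i
      using C(2)[of "(n, i)"] that C(1) by (simp add: ennreal_mult)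
    then show ?thesis using that C(1) by blast
  qed
  obtain C4 where C4: "C4 > 0" "\<And>n f. n \<ge> 1 \<Longrightarrow> f \<in> sobolev_ball s R \<Omega> \<Longrightarrow>
      L2_norm_on \<Omega> (\<lambda>y. reconstruct n (\<phi> n) (sample (x n) f) y - f y) \<le> ennreal (C4 * real n powr (- s\<^sub>a / d))"
  proof -
    obtain C where C: "C > 0" "\<And>n. n \<in> {1..} \<Longrightarrow> (SUP f \<in> sobolev_ball s R \<Omega>.
        L2_norm_on \<Omega> (\<lambda>y. reconstruct n (\<phi> n) (sample (x n) f) y - f y)) \<le> ennreal C * ennreal (h n powr s\<^sub>a)"
      by (rule lesssim_onE[OF conjunct1[OF approx[OF s_gt s_sa R_pos, unfolded sim_on_def]]]) (rule that)
    have "L2_norm_on \<Omega> (\<lambda>y. reconstruct n (\<phi> n) (sample (x n) f) y - f y)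
        \<le> ennreal (C * C1 powr s\<^sub>a * real n powr (- s\<^sub>a / d))"
      if n: "n \<ge> 1" and f: "f \<in> sobolev_ball s R \<Omega>" for n f
    proof -
      \<comment> \<open>The bound on \<open>h n\<close> turns the approximation order into a power
        of \<open>n\<close>, since raising to the positive power \<open>s\<^sub>a\<close> is
        monotone.\<close>
      have "h n powr s\<^sub>a \<le> (C1 * ?N n) powr s\<^sub>a"
        using h_pos[OF n] C1(2)[OF n] sa_pos by (intro powr_mono2) auto
      also have "\<dots> = C1 powr s\<^sub>a * real n powr (- s\<^sub>a / d)"
        using C1(1) n by (simp add: powr_mult powr_powr)
      finally have h: "h n powr s\<^sub>a \<le> C1 powr s\<^sub>a * real n powr (- s\<^sub>a / d)" .
      have "L2_norm_on \<Omega> (\<lambda>y. reconstruct n (\<phi> n) (sample (x n) f) y - f y) \<le> ennreal C * ennreal (h n powr s\<^sub>a)"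
        using C(2)[of n] n SUP_upper[OF f, of "\<lambda>f. L2_norm_on \<Omega> (\<lambda>y. reconstruct n (\<phi> n) (sample (x n) f) y - f y)"]
        by (auto intro: order_trans)
      also have "\<dots> \<le> ennreal (C * C1 powr s\<^sub>a * real n powr (- s\<^sub>a / d))"
        using C(1) h by (simp add: ennreal_mult[symmetric] mult.assoc)
      finally show ?thesis .
    qed
    then show ?thesis using that[of "C * C1 powr s\<^sub>a"] C(1) C1(1) by simp
  qed
  obtain C5 where C5: "C5 > 0" "\<And>\<beta> f. \<beta> > 0 \<Longrightarrow> f \<in> sobolev_ball s R \<Omega> \<Longrightarrow>
      L2_norm_on \<Omega> (\<lambda>y. regularise \<Omega> K \<beta> f y - f y) \<le> ennreal (C5 * \<beta> ^ s\<^sub>r)"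
  proof -
    obtain C where C: "C > 0" "\<And>\<beta>. \<beta> \<in> {0<..} \<Longrightarrow> (SUP f \<in> sobolev_ball s R \<Omega>.
        L2_norm_on \<Omega> (\<lambda>y. regularise \<Omega> K \<beta> f y - f y)) \<le> ennreal C * ennreal (\<beta> ^ s\<^sub>r)"
      by (rule lesssim_onE[OF reg_upper[OF s_gt s_sr R_pos]]) (rule that)
    have "L2_norm_on \<Omega> (\<lambda>y. regularise \<Omega> K \<beta> f y - f y) \<le> ennreal (C * \<beta> ^ s\<^sub>r)"
      if \<beta>: "\<beta> > 0" and f: "f \<in> sobolev_ball s R \<Omega>" for \<beta> f
      using C(2)[of \<beta>] C(1) \<beta> SUP_upper[OF f, of "\<lambda>f. L2_norm_on \<Omega> (\<lambda>y. regularise \<Omega> K \<beta> f y - f y)"]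
      by (simp add: ennreal_mult[symmetric] order_trans)
    then show ?thesis using that C(1) by blast
  qed
  \<comment> \<open>\<open>k1\<close> is the \<open>L1\<close> norm of \<open>K\<close>, and
    \<open>k2\<close> below is the square of its \<open>L2\<close> norm.\<close>
  obtain k1 where k1: "(\<integral>\<^sup>+x. ennreal \<bar>K x\<bar> \<partial>lborel) = ennreal k1" "k1 \<ge> 0"
    using nn_integral_compact_support_finite[OF K_cont K_supp, of 1]
    by (cases "\<integral>\<^sup>+x. ennreal \<bar>K x\<bar> \<partial>lborel") auto
  obtain k2 where k2: "(\<integral>\<^sup>+x. ennreal ((K x)\<^sup>2) \<partial>lborel) = ennreal k2" "k2 \<ge> 0"
    using nn_integral_compact_support_finite[OF K_cont K_supp, of 2]
    by (cases "\<integral>\<^sup>+x. ennreal ((K x)\<^sup>2) \<partial>lborel") auto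
  define D where "D = k1\<^sup>2 * C2\<^sup>2 * C1 powr d + k2 * C3\<^sup>2 * (C1 powr d)\<^sup>2"
  have D_nonneg: "D \<ge> 0" using k2 by (simp add: D_def)
  \<comment> \<open>The factor \<open>2\<close> comes from \<open>sum3_power2_le\<close>. The
    coefficients \<open>k1 * C4\<close>, \<open>C5\<close> and \<open>sqrt D\<close> belong to
    approximation, regularisation and noise, and their sum dominates each.\<close>
  define C where "C = 2 * (k1 * C4 + C5 + sqrt D)"
  have C_pos: "C > 0" using C4(1) C5(1) k1(2) D_nonneg by (simp add: C_def add_nonneg_pos add_pos_nonneg)

  have bound: "recon_error \<Omega> K s R (x n) (\<phi> n) M \<xi> \<beta> \<sigma> n
      \<le> ennreal (C * (\<sigma> * ?m \<beta> n + real n powr (- s\<^sub>a / d) + \<beta> ^ s\<^sub>r))"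
    if n: "n \<ge> 1" and noise: "standard_noise M n \<xi>" and \<sigma>: "\<sigma> > 0" and \<beta>: "\<beta> > 0"
    for n \<beta> \<sigma> and M :: "'w measure" and \<xi>
    unfolding recon_error_def
  \<comment> \<open>Supremum and root are removed first: for each \<open>f\<close> the mean square
    has to stay below the square of the claimed bound.\<close>
  proof (intro SUP_least ennreal_sqrt_le)
    fix f assume f: "f \<in> sobolev_ball s R \<Omega>"
    have f_cont: "continuous_on (closure \<Omega>) f"
      using f by (simp add: sobolev_ball_def)
    have \<phi>_cont: "continuous_on (closure \<Omega>) (\<phi> n i)" if "i \<in> {1..n}" for i
      using phi_cont that by simp
    let ?r = "\<lambda>y. reconstruct n (\<phi> n) (sample (x n) f) y - f y"
    let ?a = "k1 * (C4 * real n powr (- s\<^sub>a / d))"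
    let ?b = "C5 * \<beta> ^ s\<^sub>r"
    let ?c = "sqrt D * (\<sigma> * ?m \<beta> n)"
    have "continuous_on (closure \<Omega>) ?r"
      by (intro continuous_on_diff continuous_on_reconstruct \<phi>_cont f_cont)
    then have "(L2_norm_on \<Omega> (regularise \<Omega> K \<beta> ?r))\<^sup>2 \<le> (ennreal k1)\<^sup>2 * (L2_norm_on \<Omega> ?r)\<^sup>2"
      using regularise_L2_L2[OF K_cont set_borel_measurable_closure[OF domain(1)] \<beta>, of ?r] k1(1) by simp
    also have "\<dots> \<le> (ennreal k1)\<^sup>2 * (ennreal (C4 * real n powr (- s\<^sub>a / d)))\<^sup>2"
      using C4(2)[OF n f] by (intro mult_left_mono power_mono) auto
    also have "\<dots> = ennreal (?a\<^sup>2)"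
      using k1(2) C4(1) by (simp add: ennreal_power ennreal_mult[symmetric] power_mult_distrib)
    finally have a: "(L2_norm_on \<Omega> (regularise \<Omega> K \<beta> ?r))\<^sup>2 \<le> ennreal (?a\<^sup>2)" .
    have "(L2_norm_on \<Omega> (\<lambda>y. regularise \<Omega> K \<beta> f y - f y))\<^sup>2 \<le> (ennreal ?b)\<^sup>2"
      using C5(2)[OF \<beta> f] by (rule power_mono) simp
    then have b: "(L2_norm_on \<Omega> (\<lambda>y. regularise \<Omega> K \<beta> f y - f y))\<^sup>2 \<le> ennreal (?b\<^sup>2)"
      using C5(1) \<beta> by (simp add: ennreal_power)
    \<comment> \<open>Each of the \<open>n\<close> summands carries a factor \<open>1 / n\<close>,
      so the sum over \<open>i\<close> leaves \<open>D\<close> times the squared minimum.\<close>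
    have "(L2_norm_on \<Omega> (regularise \<Omega> K \<beta> (\<phi> n i)))\<^sup>2 \<le> ennreal (D * (?m \<beta> n)\<^sup>2 / real n)"
      if "i \<in> {1..n}" for i
      unfolding D_def d_def
      by (rule noise_term_le[OF K_cont domain(1,2) \<phi>_cont[OF that] h_pos[OF n]])
        (use that n \<beta> C1 C2 C3 k1 k2 in \<open>simp_all add: d_def\<close>)
    then have "ennreal (\<sigma>\<^sup>2) * (\<Sum>i=1..n. (L2_norm_on \<Omega> (regularise \<Omega> K \<beta> (\<phi> n i)))\<^sup>2)
        \<le> ennreal (\<sigma>\<^sup>2) * (\<Sum>i=1..n. ennreal (D * (?m \<beta> n)\<^sup>2 / real n))"
      by (intro mult_left_mono sum_mono) auto
    also have "\<dots> = ennreal (\<sigma>\<^sup>2) * ennreal (\<Sum>i=1..n. D * (?m \<beta> n)\<^sup>2 / real n)"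
      using D_nonneg by (subst sum_ennreal) auto
    also have "\<dots> = ennreal (?c\<^sup>2)"
      using n D_nonneg by (simp add: ennreal_mult[symmetric] power_mult_distrib mult_ac)
    finally have c: "ennreal (\<sigma>\<^sup>2) * (\<Sum>i=1..n. (L2_norm_on \<Omega> (regularise \<Omega> K \<beta> (\<phi> n i)))\<^sup>2)
        \<le> ennreal (?c\<^sup>2)" .
    have nonneg: "?a \<ge> 0" "?b \<ge> 0" "?c \<ge> 0"
      using k1 C4(1) C5(1) \<beta> \<sigma> D_nonneg by simp_all
    have "3 * ?a\<^sup>2 + 3 * ?b\<^sup>2 + 3 * ?c\<^sup>2 \<le> (2 * (?a + ?b + ?c))\<^sup>2"
      by (rule sum3_power2_le[OF nonneg])
    also have "\<dots> \<le> (C * (\<sigma> * ?m \<beta> n + real n powr (- s\<^sub>a / d) + \<beta> ^ s\<^sub>r))\<^sup>2"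
    proof (rule power_mono)
      \<comment> \<open>Each of the three coefficients is replaced by their sum.\<close>
      have "u * p \<le> (u + v + w) * p" if "u \<ge> 0" "v \<ge> 0" "w \<ge> 0" "p \<ge> 0" for u v w p :: real
        using that by (intro mult_right_mono) auto
      from this[of "k1 * C4" C5 "sqrt D" "real n powr (- s\<^sub>a / d)"]
        this[of C5 "k1 * C4" "sqrt D" "\<beta> ^ s\<^sub>r"]
        this[of "sqrt D" "k1 * C4" C5 "\<sigma> * ?m \<beta> n"]
      show "2 * (?a + ?b + ?c) \<le> C * (\<sigma> * ?m \<beta> n + real n powr (- s\<^sub>a / d) + \<beta> ^ s\<^sub>r)"
        using k1 C4(1) C5(1) \<beta> \<sigma> D_nonneg by (simp add: C_def algebra_simps)
    qed (use nonneg in simp)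
    finally have real: "3 * ?a\<^sup>2 + 3 * ?b\<^sup>2 + 3 * ?c\<^sup>2
        \<le> (C * (\<sigma> * ?m \<beta> n + real n powr (- s\<^sub>a / d) + \<beta> ^ s\<^sub>r))\<^sup>2" .
    have "(\<integral>\<^sup>+\<omega>. (L2_norm_on \<Omega> (\<lambda>y. regularise \<Omega> K \<beta>
          (reconstruct n (\<phi> n) (\<lambda>i. sample (x n) f i + \<sigma> * \<xi> i \<omega>)) y - f y))\<^sup>2 \<partial>M)
        \<le> 3 * (L2_norm_on \<Omega> (regularise \<Omega> K \<beta> ?r))\<^sup>2
          + 3 * (L2_norm_on \<Omega> (\<lambda>y. regularise \<Omega> K \<beta> f y - f y))\<^sup>2
          + 3 * (ennreal (\<sigma>\<^sup>2) * (\<Sum>i=1..n. (L2_norm_on \<Omega> (regularise \<Omega> K \<beta> (\<phi> n i)))\<^sup>2))"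
      by (rule expected_error_le[OF K_cont domain(1,2) \<phi>_cont f_cont noise])
    also have "\<dots> \<le> 3 * ennreal (?a\<^sup>2) + 3 * ennreal (?b\<^sup>2) + 3 * ennreal (?c\<^sup>2)"
      by (intro add_mono mult_left_mono a b c) auto
    also have "\<dots> = ennreal (3 * ?a\<^sup>2 + 3 * ?b\<^sup>2 + 3 * ?c\<^sup>2)"
      by (simp only: ennreal_plus ennreal_mult ennreal_numeral zero_le_power2 mult_nonneg_nonneg
          zero_le_numeral add_nonneg_nonneg)
    also have "\<dots> \<le> ennreal ((C * (\<sigma> * ?m \<beta> n + real n powr (- s\<^sub>a / d) + \<beta> ^ s\<^sub>r))\<^sup>2)"
      using real by (rule ennreal_leI)
    also have "\<dots> = (ennreal (C * (\<sigma> * ?m \<beta> n + real n powr (- s\<^sub>a / d) + \<beta> ^ s\<^sub>r)))\<^sup>2"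
      using C_pos \<sigma> \<beta> by (simp add: ennreal_power)
    finally show "(\<integral>\<^sup>+\<omega>. (L2_norm_on \<Omega> (\<lambda>y. regularise \<Omega> K \<beta>
          (reconstruct n (\<phi> n) (\<lambda>i. sample (x n) f i + \<sigma> * \<xi> i \<omega>)) y - f y))\<^sup>2 \<partial>M)
        \<le> (ennreal (C * (\<sigma> * ?m \<beta> n + real n powr (- s\<^sub>a / d) + \<beta> ^ s\<^sub>r)))\<^sup>2" .
  qed

  \<comment> \<open>The infimum is tested at one \<open>\<beta>\<close>: a noise term of at most
    \<open>t\<close> and a power of \<open>\<beta>\<close> equal to \<open>t\<close> contribute at
    most \<open>2 * t\<close> together.\<close>
  have inf_bound: "(INF \<beta> \<in> {0<..}. recon_error \<Omega> K s R (x n) (\<phi> n) M \<xi> \<beta> \<sigma> n)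
      \<le> ennreal (2 * C * (t + real n powr (- s\<^sub>a / d)))"
    if "n \<ge> 1" "standard_noise M n \<xi>" "\<sigma> > 0" "\<beta> > 0" "\<sigma> * ?m \<beta> n \<le> t" "\<beta> ^ s\<^sub>r = t"
    for n \<beta> \<sigma> t and M :: "'w measure" and \<xi>
  proof -
    have "(INF \<beta> \<in> {0<..}. recon_error \<Omega> K s R (x n) (\<phi> n) M \<xi> \<beta> \<sigma> n)
        \<le> recon_error \<Omega> K s R (x n) (\<phi> n) M \<xi> \<beta> \<sigma> n"
      using that by (intro INF_lower) simp
    also have "\<dots> \<le> ennreal (C * (\<sigma> * ?m \<beta> n + real n powr (- s\<^sub>a / d) + \<beta> ^ s\<^sub>r))"
      using that by (intro bound)
    also have "\<dots> \<le> ennreal (C * (2 * (t + real n powr (- s\<^sub>a / d))))"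
    proof (intro ennreal_leI mult_left_mono)
      have "u + p + q \<le> 2 * (v + p)" if "u \<le> v" "q = v" "p \<ge> 0" for u p q v :: real
        using that by (simp add: add_mono)
      then show "\<sigma> * ?m \<beta> n + real n powr (- s\<^sub>a / d) + \<beta> ^ s\<^sub>r \<le> 2 * (t + real n powr (- s\<^sub>a / d))"
        using that(5,6) powr_ge_zero by blast
    qed (use C_pos in simp)
    finally show ?thesis by (simp add: mult_ac)
  qed
  have sr: "s\<^sub>r \<ge> 1" using sr_ge by simp
  \<comment> \<open>With \<open>\<beta>\<close> the \<open>s\<^sub>r\<close>-th root of
    \<open>\<sigma>\<close>, its power is \<open>\<sigma>\<close>, and the minimum, being at most
    \<open>1\<close>, keeps the noise term at most \<open>\<sigma>\<close>.\<close>
  have small: "(INF \<beta> \<in> {0<..}. recon_error \<Omega> K s R (x n) (\<phi> n) M \<xi> \<beta> \<sigma> n)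
      \<le> ennreal (2 * C * (\<sigma> + real n powr (- s\<^sub>a / d)))"
    if "n \<ge> 1" "standard_noise M n \<xi>" "\<sigma> > 0" for n \<sigma> and M :: "'w measure" and \<xi>
  proof (rule inf_bound[OF that])
    show "root s\<^sub>r \<sigma> > 0" "root s\<^sub>r \<sigma> ^ s\<^sub>r = \<sigma>"
      using sr that by (auto intro: real_root_pow_pos2)
    have "?m (root s\<^sub>r \<sigma>) n \<le> 1 powr (d / 2)"
      using d_pos sr that by (intro powr_mono2) auto
    then show "\<sigma> * ?m (root s\<^sub>r \<sigma>) n \<le> \<sigma>"
      using that by simp
  qed
  have large: "(INF \<beta> \<in> {0<..}. recon_error \<Omega> K s R (x n) (\<phi> n) M \<xi> \<beta> \<sigma> n)
      \<le> ennreal (2 * C * (\<sigma> powr (2 * real s\<^sub>r / (2 * real s\<^sub>r + d))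
          * real n powr (- real s\<^sub>r / (2 * real s\<^sub>r + d)) + real n powr (- s\<^sub>a / d)))"
    if "n \<ge> 1" "standard_noise M n \<xi>" "\<sigma> > 0" for n \<sigma> and M :: "'w measure" and \<xi>
  proof -
    define \<beta> where "\<beta> = (\<sigma> * real n powr (- 1 / 2)) powr (2 / (2 * real s\<^sub>r + d))"
    note choice = parameter_choice[OF d_pos sr that(1,3), folded \<beta>_def]
    \<comment> \<open>Dropping the \<open>1\<close> from the minimum only enlarges it, and the
      choice of \<open>\<beta>\<close> then makes the noise term equal to
      \<open>\<beta> ^ s\<^sub>r\<close>.\<close>
    have "?m \<beta> n \<le> (inverse \<beta> * ?N n) powr (d / 2)"
      using d_pos choice(1) by (intro powr_mono2) auto
    then have "\<sigma> * ?m \<beta> n \<le> \<sigma> * (inverse \<beta> * ?N n) powr (d / 2)"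
      using that by (intro mult_left_mono) auto
    then have "\<sigma> * ?m \<beta> n \<le> \<beta> ^ s\<^sub>r"
      unfolding choice(3) .
    then show ?thesis
      using inf_bound[OF that choice(1) _ choice(2)] choice(2) by simp
  qed
  show ?thesis
  proof (intro conjI allI impI)
    show "\<exists>C>0. \<forall>n\<ge>1. \<forall>(M :: 'w measure) \<xi>. standard_noise M n \<xi> \<longrightarrow>
        (\<forall>\<sigma>>0. \<forall>\<beta>>0. recon_error \<Omega> K s R (x n) (\<phi> n) M \<xi> \<beta> \<sigma> n
          \<le> ennreal (C * (\<sigma> * ?m \<beta> n + real n powr (- s\<^sub>a / d) + \<beta> ^ s\<^sub>r)))"
      using C_pos bound by blast
  next
    fix A :: real
    show "\<exists>C\<^sub>A>0. \<forall>n\<ge>1. \<forall>(M :: 'w measure) \<xi>. standard_noise M n \<xi> \<longrightarrow>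
        (\<forall>\<sigma>>0. (INF \<beta> \<in> {0<..}. recon_error \<Omega> K s R (x n) (\<phi> n) M \<xi> \<beta> \<sigma> n)
          \<le> ennreal (if \<sigma> \<le> A * real n powr (- real s\<^sub>r / d)
              then C\<^sub>A * (\<sigma> + real n powr (- s\<^sub>a / d))
              else C\<^sub>A * (\<sigma> powr (2 * real s\<^sub>r / (2 * real s\<^sub>r + d))
                 * real n powr (- real s\<^sub>r / (2 * real s\<^sub>r + d)) + real n powr (- s\<^sub>a / d))))"
    \<comment> \<open>Both \<open>small\<close> and \<open>large\<close> hold for every
      \<open>\<sigma> > 0\<close> with the constant \<open>2 * C\<close>, so this witness serves in
      either branch.\<close>
    proof (intro exI[of _ "2 * C"] conjI allI impI)
      fix n :: nat and M :: "'w measure" and \<xi> and \<sigma> :: real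
      assume "n \<ge> 1" "standard_noise M n \<xi>" "\<sigma> > 0"
      from small[OF this] large[OF this]
      show "(INF \<beta> \<in> {0<..}. recon_error \<Omega> K s R (x n) (\<phi> n) M \<xi> \<beta> \<sigma> n)
          \<le> ennreal (if \<sigma> \<le> A * real n powr (- real s\<^sub>r / d)
              then 2 * C * (\<sigma> + real n powr (- s\<^sub>a / d))
              else 2 * C * (\<sigma> powr (2 * real s\<^sub>r / (2 * real s\<^sub>r + d))
                 * real n powr (- real s\<^sub>r / (2 * real s\<^sub>r + d)) + real n powr (- s\<^sub>a / d)))"
        by (simp only: split: if_split) blast
    qed (use C_pos in simp)
  qed
qed

end
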